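(* Let $\lambda$ be a Borel function with period $\kappa>0$ and $0\le\lambda(t)\le\lambda_h\in(0,\infty)$ for all $t$. Fix $m\in\mathbb N$. Assume: 1. $\Psi$ has product form, $\Psi(s,y)=G(s)H(y)$; 2. the stability condition $$\lambda_h\int_0^\infty y\,dG(y)\cdot\lim_{y\uparrow\infty}[1-H(y)]<1$$ holds, where in particular $\int_0^\infty y\,dG(y)<\infty$ is required. Then: - if $m=1$, $E\eta^*_\lambda<\infty$; - if $m\ge2$ and $\int_0^\infty y^m\,dG(y)<\infty$, then $E(\eta^*_\lambda)^m<\infty$.
   Context: $\mathcal L$ is the set of all bivariate cdfs with support in $(0,\infty)\times(0,\infty]$. Here $G$ is the service-time cdf on $(0,\infty)$ and $H$ is the patience-time cdf on $(0,\infty]$, so $\lim_{y\uparrow\infty}[1-H(y)]=P(Y=\infty)$. The $M_t/G(\Psi)/1+H(\Psi)$ queue is defined as follows. - It is a single-server FCFS queue with infinite waiting room, started empty at time $0$. - Arrivals form an inhomogeneous Poisson process of rate $\lambda(\cdot)$. - $(S_i,Y_i)$ are iid with cdf $\Psi$ and independent of the arrivals. - The $i$-th arrival at time $T_i$ joins if and only if $Y_i\ge W_\lambda(T_i-)$, where $W_\lambda$ is the workload (decreasing at unit rate while positive), and if he joins the workload jumps by $S_i$. $N^*_\lambda(t)$ is the number of customers who joined in $[0,t]$. Define $$\xi_\lambda=\inf\{\kappa n:n\in\mathbb N,\ W_\lambda(\kappa n)=0\},\qquad \eta^*_\lambda=N^*_\lambda(\xi_\lambda).$$ *)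

theory Defs
  imports "HOL-Probability.Probability"
begin

text \<open>A sample path is given by a counting function n (n t = number of arrivals
in [0,t]), service times s i and patience times y i (values in (0,\<infinity>])
of the i-th arrival (i = 0,1,2,...).\<close>

text \<open>Arrival time of the i-th arrival (0-indexed).  Only used when i < n t
for some t.\<close>
definition arr :: "(real \<Rightarrow> nat) \<Rightarrow> nat \<Rightarrow> real" where
  "arr n i = Inf {t. 0 \<le> t \<and> i < n t}"

text \<open>Workload just before the i-th arrival, W(T_i -).\<close>
fun wpre :: "(real \<Rightarrow> nat) \<Rightarrow> (nat \<Rightarrow> real) \<Rightarrow> (nat \<Rightarrow> ennreal) \<Rightarrow> nat \<Rightarrow> real" where
  "wpre n s y 0 = 0"
| "wpre n s y (Suc i) =
     max 0 (wpre n s y i + (if ennreal (wpre n s y i) \<le> y i then s i else 0)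
            - (arr n (Suc i) - arr n i))"

definition joins :: "(real \<Rightarrow> nat) \<Rightarrow> (nat \<Rightarrow> real) \<Rightarrow> (nat \<Rightarrow> ennreal) \<Rightarrow> nat \<Rightarrow> bool" where
  "joins n s y i \<longleftrightarrow> ennreal (wpre n s y i) \<le> y i"

text \<open>Workload W(t) at time t \<ge> 0 (right-continuous).\<close>
definition workload :: "(real \<Rightarrow> nat) \<Rightarrow> (nat \<Rightarrow> real) \<Rightarrow> (nat \<Rightarrow> ennreal) \<Rightarrow> real \<Rightarrow> real" where
  "workload n s y t =
     (if n t = 0 then 0
      else let k = n t - 1 in
        max 0 (wpre n s y k + (if joins n s y k then s k else 0) - (t - arr n k)))"

definition njoined :: "(real \<Rightarrow> nat) \<Rightarrow> (nat \<Rightarrow> real) \<Rightarrow> (nat \<Rightarrow> ennreal) \<Rightarrow> real \<Rightarrow> nat" where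
  "njoined n s y t = card {i. i < n t \<and> joins n s y i}"

definition eta_star :: "real \<Rightarrow> (real \<Rightarrow> nat) \<Rightarrow> (nat \<Rightarrow> real) \<Rightarrow> (nat \<Rightarrow> ennreal) \<Rightarrow> ennreal" where
  "eta_star \<kappa> n s y =
     (if \<exists>k::nat. 1 \<le> k \<and> workload n s y (\<kappa> * real k) = 0
      then of_nat (njoined n s y (\<kappa> * real (LEAST k::nat. 1 \<le> k \<and> workload n s y (\<kappa> * real k) = 0)))
      else \<infinity>)"

definition inhom_poisson_process ::
  "'a measure \<Rightarrow> (real \<Rightarrow> real) \<Rightarrow> (real \<Rightarrow> 'a \<Rightarrow> nat) \<Rightarrow> bool" where
  "inhom_poisson_process M lam N \<longleftrightarrow>
     (\<forall>t. N t \<in> measurable M (count_space UNIV)) \<and>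
     \<comment> \<open>sample paths are counting functions on [0,\<infinity>)\<close>
     (\<forall>\<omega>\<in>space M. N 0 \<omega> = 0 \<and> mono_on {0..} (\<lambda>t. N t \<omega>) \<and>
        (\<forall>t\<ge>0. \<exists>d>0. \<forall>u. t \<le> u \<and> u \<le> t + d \<longrightarrow> N u \<omega> = N t \<omega>)) \<and>
     \<comment> \<open>Poisson distributed increments with mean the integral of the rate\<close>
     (\<forall>s t k. 0 \<le> s \<and> s \<le> t \<longrightarrow>
        measure M {\<omega>\<in>space M. N t \<omega> - N s \<omega> = k} =
          exp (- integral {s..t} lam) * (integral {s..t} lam) ^ k / fact k) \<and>
     \<comment> \<open>independent increments\<close>
     (\<forall>(ts::nat \<Rightarrow> real) K. 0 \<le> ts 0 \<and> (\<forall>j<K. ts j \<le> ts (Suc j)) \<longrightarrow>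
        prob_space.indep_vars M (\<lambda>_. count_space UNIV)
          (\<lambda>j \<omega>. N (ts (Suc j)) \<omega> - N (ts j) \<omega>) {..<K})"

end

theory Submission
  imports Defs
begin

text \<open>For the moment of order n + 1, write Z = z + \<epsilon> C + D. Far from 0 the drift
  gains order Z^n against a second-order error of order Z^(n-1). Near 0 no drift is available, the
  error is of order Z^n, and the change of the weight must beat it. This is why the weight
  multiplies the power: Z contains the count and can be huge although D is small, so an additive
  correction at low levels would be swamped, whereas a multiplicative one gains order Z^(n+1). A
  large z then makes both gains win everywhere.

  The drift is controlled with the mean service time alone, by truncating the services; the moment
  of order n + 1 enters only through the constant of the error terms. Under the product form the
  mean patient work per customer is the mean service time times P(Y > y0), which tends to the
  quantity in the stability condition.

  The period in which the chain takes its next step starts at a random customer number. The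
  conditioning this requires is done by summing over the possible values of that number.\<close>

text \<open>
Only the workload at the grid points \<open>\<kappa> k\<close> matters.  If the workload exceeds
\<open>y0 + \<kappa>\<close> at the start of a period, only customers with patience above \<open>y0\<close> join, and by the stability
condition \<open>y0\<close> can be chosen so that these bring less than \<open>\<kappa>\<close> units of work per period
on average; at low levels a period without arrivals lowers the workload by \<open>\<kappa>\<close> with probability
at least \<open>exp (- \<lambda>\<^sub>h \<kappa>)\<close>.  The grid workload is therefore dominated, until it first vanishes, by a
chain \<open>D\<close> driven by independent blocks (number of arrivals, total work, patient work).  Let \<open>C\<close> count
the arrivals and the periods up to the absorption of \<open>D\<close>.  For large \<open>z\<close> and small \<open>\<epsilon>\<close>, the
function \<open>(z + \<epsilon> C + D)^m\<close> times a bounded weight that decreases as \<open>D\<close> approaches 0 is a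
supermartingale.  Hence \<open>E C^m\<close> stays bounded in time, and by monotone convergence so does
the moment of the limit of \<open>C\<close>, which dominates \<open>\<eta>\<^sup>*\<close> and is infinite if absorption never occurs.
\<close>

section \<open>Sample paths\<close>

definition counting_path :: "(real \<Rightarrow> nat) \<Rightarrow> bool" where
  "counting_path n \<longleftrightarrow> n 0 = 0 \<and> mono_on {0..} n \<and>
     (\<forall>t\<ge>0. \<exists>d>0. \<forall>u. t \<le> u \<and> u \<le> t + d \<longrightarrow> n u = n t)"

lemma counting_path_mono: "counting_path n \<Longrightarrow> 0 \<le> t \<Longrightarrow> t \<le> t' \<Longrightarrow> n t \<le> n t'"
  by (auto simp: counting_path_def mono_on_def)

text \<open>A counting path stays constant for a while to the right of every time, so the infimum in
  \<open>arr\<close> is attained. The premise \<open>i < n T\<close> keeps the set behind it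
  nonempty.\<close>

lemma arr_le_iff:
  assumes n: "counting_path n" and i: "i < n T" "0 \<le> T" and t: "0 \<le> t"
  shows "arr n i \<le> t \<longleftrightarrow> i < n t"
proof
  assume le: "arr n i \<le> t"
  show "i < n t"
  proof (rule ccontr)
    assume "\<not> i < n t"
    then have nt: "n t \<le> i" by simp
    obtain d where d: "d > 0" "\<And>u. t \<le> u \<Longrightarrow> u \<le> t + d \<Longrightarrow> n u = n t"
      using n t unfolding counting_path_def by meson
    have "t + d \<le> u" if u: "0 \<le> u" "i < n u" for u
    proof (rule ccontr)
      assume "\<not> t + d \<le> u"
      then have "n u \<le> n (t + d)"
        using counting_path_mono[OF n u(1)] by simp
      also have "\<dots> = n t" using d(2)[of "t + d"] d(1) by linarith
      finally show False using u nt by linarith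
    qed
    then have "t + d \<le> arr n i"
      unfolding arr_def using i by (intro cInf_greatest) auto
    then show False using le d(1) by linarith
  qed
next
  assume "i < n t"
  then show "arr n i \<le> t"
    unfolding arr_def using t by (intro cInf_lower bdd_belowI[of _ 0]) auto
qed

lemma arr_mono:
  assumes n: "counting_path n" and i: "i \<le> j" "j < n T" "0 \<le> T"
  shows "arr n i \<le> arr n j"
  unfolding arr_def using i by (intro cInf_superset_mono bdd_belowI[of _ 0]) auto

lemma workload_no_arrivals:
  assumes "n t' = n t" "t \<le> t'"
  shows "workload n s y t' = max 0 (workload n s y t - (t' - t))"
  using assms by (auto simp: workload_def Let_def max_def)

lemma workload_nonneg: "0 \<le> workload n s y t"
  by (simp add: workload_def Let_def)

lemma wpre_first_after:
  assumes n: "counting_path n" and t: "0 \<le> t" "t \<le> t'" "n t < n t'"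
  shows "wpre n s y (n t) = max 0 (workload n s y t - (arr n (n t) - t))"
proof -
  \<comment> \<open>Counting from 0, arrival \<open>n t\<close> is the first one after
    \<open>t\<close>. As it comes no earlier than \<open>t\<close>, the nested truncations at 0
    merge into one.\<close>
  have "t < arr n (n t)"
    using arr_le_iff[OF n t(3) _ t(1)] t by force
  then show ?thesis
    by (cases "n t") (auto simp: workload_def Let_def joins_def)
qed

lemma workload_last_arrival:
  assumes "0 < n t'"
  shows "workload n s y t' = max 0 (wpre n s y (n t' - 1)
     + (if joins n s y (n t' - 1) then s (n t' - 1) else 0) - (t' - arr n (n t' - 1)))"
  using assms by (simp add: workload_def Let_def)

text \<open>Crude bound valid at every level: let everybody join and let the server idle.\<close>

lemma wpre_le_sum:
  assumes n: "counting_path n" and t: "0 \<le> t" "t \<le> t'" and s: "\<And>i. 0 \<le> s i"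
    and i: "n t \<le> i" "i < n t'"
  shows "wpre n s y i \<le> workload n s y t + (\<Sum>j\<in>{n t..<i}. s j)"
  using i
proof (induction i rule: dec_induct)
  case base
  have "t < arr n (n t)"
    using arr_le_iff[OF n base _ t(1)] t by force
  then show ?case
    using wpre_first_after[OF n t base, of s y] workload_nonneg[of n s y t] by simp
next
  case (step i)
  have "arr n i \<le> arr n (Suc i)"
    using arr_mono[OF n _ step.prems] t by simp
  moreover have "wpre n s y i \<le> workload n s y t + (\<Sum>j\<in>{n t..<i}. s j)"
    using step by simp
  moreover have "0 \<le> (\<Sum>j\<in>{n t..<i}. s j)" by (simp add: sum_nonneg s)
  moreover have "(\<Sum>j\<in>{n t..<Suc i}. s j) = (\<Sum>j\<in>{n t..<i}. s j) + s i"
    using step.hyps by simp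
  ultimately show ?case
    using s[of i] workload_nonneg[of n s y t] by (simp add: max_def)
qed

lemma workload_le_sum:
  assumes n: "counting_path n" and t: "0 \<le> t" "t \<le> t'" and s: "\<And>i. 0 \<le> s i"
  shows "workload n s y t' \<le> workload n s y t + (\<Sum>j\<in>{n t..<n t'}. s j)"
proof (cases "n t' = n t")
  case True
  then show ?thesis
    using workload_no_arrivals[of n t' t s y] t workload_nonneg[of n s y t] by simp
next
  case False
  then have lt: "n t < n t'"
    using counting_path_mono[OF n t] by simp
  define k where "k = n t' - 1"
  have k: "n t' = Suc k" "n t \<le> k" "k < n t'" using lt by (auto simp: k_def)
  have "arr n k \<le> t'" using arr_le_iff[OF n k(3)] k t by simp
  moreover have "wpre n s y k \<le> workload n s y t + (\<Sum>j\<in>{n t..<k}. s j)"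
    using wpre_le_sum[OF n t s k(2,3)] .
  moreover have "workload n s y t' = max 0 (wpre n s y k + (if joins n s y k then s k else 0) - (t' - arr n k))"
    using workload_last_arrival[of n t' s y] k by simp
  moreover have "0 \<le> (\<Sum>j\<in>{n t..<k}. s j)" by (simp add: sum_nonneg s)
  moreover have "(\<Sum>j\<in>{n t..<n t'}. s j) = (\<Sum>j\<in>{n t..<k}. s j) + s k"
    using k by simp
  ultimately show ?thesis
    using s[of k] workload_nonneg[of n s y t] by (simp add: max_def)
qed

text \<open>As long as the workload exceeds \<open>w0\<close>, only customers whose patience exceeds \<open>w0\<close> join.\<close>

lemma wpre_high:
  fixes y :: "nat \<Rightarrow> ennreal"
  assumes n: "counting_path n" and t: "0 \<le> t" "t \<le> t'" and s: "\<And>i. 0 \<le> s i"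
    and high: "w0 + (t' - t) < workload n s y t" and w0: "0 \<le> w0"
    and i: "n t \<le> i" "i < n t'"
  shows "workload n s y t - (arr n i - t) \<le> wpre n s y i \<and>
    wpre n s y i \<le> workload n s y t - (arr n i - t)
        + (\<Sum>j\<in>{n t..<i}. if ennreal w0 < y j then s j else 0)"
  using i
proof (induction i rule: dec_induct)
  case base
  have "arr n (n t) \<le> t'"
    using arr_le_iff[OF n base, of t'] t base by simp
  then show ?case
    using wpre_first_after[OF n t base, of s y] high w0 by simp
next
  case (step i)
  let ?W = "workload n s y t" and ?c = "\<lambda>j. if ennreal w0 < y j then s j else 0"
  have i: "i < n t'" using step by simp
  have a: "arr n i \<le> arr n (Suc i)" "arr n (Suc i) \<le> t'"
    using arr_mono[OF n _ step.prems] arr_le_iff[OF n step.prems, of t'] t step.prems by auto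
  have IH: "?W - (arr n i - t) \<le> wpre n s y i"
    "wpre n s y i \<le> ?W - (arr n i - t) + (\<Sum>j\<in>{n t..<i}. ?c j)"
    using step i by auto
  \<comment> \<open>The lower bound in the induction claim is there for this: the server removes at
    most \<open>t' - t\<close>, so the level stays above \<open>w0\<close>. Hence joining forces
    \<open>w0 < y i\<close>, and the truncation at 0 is inactive.\<close>
  have w: "w0 < wpre n s y i" using IH(1) high a by linarith
  define g where "g = (if ennreal (wpre n s y i) \<le> y i then s i else 0)"
  have g: "0 \<le> g" "g \<le> ?c i"
    using ennreal_lessI[OF _ w] w w0 s[of i] by (auto simp: g_def dest: less_le_trans)
  have pos: "0 \<le> wpre n s y i + g - (arr n (Suc i) - arr n i)"
    using IH(1) g high w0 a by linarith
  have eq: "wpre n s y (Suc i) = wpre n s y i + g - (arr n (Suc i) - arr n i)"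
    using pos by (simp add: g_def)
  have "(\<Sum>j\<in>{n t..<Suc i}. ?c j) = (\<Sum>j\<in>{n t..<i}. ?c j) + ?c i"
    using step.hyps by simp
  then show ?case unfolding eq using IH g by linarith
qed

lemma workload_high:
  fixes y :: "nat \<Rightarrow> ennreal"
  assumes n: "counting_path n" and t: "0 \<le> t" "t \<le> t'" and s: "\<And>i. 0 \<le> s i"
    and high: "w0 + (t' - t) < workload n s y t" and w0: "0 \<le> w0"
  shows "workload n s y t' \<le> workload n s y t - (t' - t)
        + (\<Sum>j\<in>{n t..<n t'}. if ennreal w0 < y j then s j else 0)"
proof (cases "n t' = n t")
  case True
  then show ?thesis
    using workload_no_arrivals[of n t' t s y] t high w0 by simp
next
  case False
  let ?W = "workload n s y t" and ?c = "\<lambda>j. if ennreal w0 < y j then s j else 0"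
  have lt: "n t < n t'"
    using counting_path_mono[OF n t] False by simp
  define k where "k = n t' - 1"
  have k: "n t' = Suc k" "n t \<le> k" "k < n t'" using lt by (auto simp: k_def)
  have a: "arr n k \<le> t'" using arr_le_iff[OF n k(3)] k t by simp
  have b: "?W - (arr n k - t) \<le> wpre n s y k"
    "wpre n s y k \<le> ?W - (arr n k - t) + (\<Sum>j\<in>{n t..<k}. ?c j)"
    using wpre_high[OF n t s high w0 k(2,3)] by auto
  have w: "w0 < wpre n s y k" using b(1) high a by linarith
  define g where "g = (if joins n s y k then s k else 0)"
  have g: "0 \<le> g" "g \<le> ?c k"
    using ennreal_lessI[OF _ w] w w0 s[of k] by (auto simp: g_def joins_def dest: less_le_trans)
  have "workload n s y t' = max 0 (wpre n s y k + g - (t' - arr n k))"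
    using workload_last_arrival[of n t' s y] k by (simp add: g_def)
  moreover have "0 \<le> wpre n s y k + g - (t' - arr n k)"
    using b(1) g high w0 a by linarith
  moreover have "(\<Sum>j\<in>{n t..<n t'}. ?c j) = (\<Sum>j\<in>{n t..<k}. ?c j) + ?c k"
    using k by simp
  ultimately show ?thesis using b g by linarith
qed

section \<open>A dominating chain on the grid\<close>

text \<open>One period of length \<open>\<kappa>\<close> with \<open>b\<close> arrivals of total work \<open>q\<close>, of which patient customers
bring \<open>p\<close>.  The maximum in the last case covers a workload that is still below \<open>w\<close> when the
bound \<open>d\<close> is already above it; it is needed because the workload is not monotone in its past
(a larger workload makes fewer customers join).  The state 0 is absorbing, so the chain starts in
\<open>\<kappa>\<close> rather than in the actual initial workload 0.\<close>

definition bound_step :: "real \<Rightarrow> real \<Rightarrow> nat \<Rightarrow> real \<Rightarrow> real \<Rightarrow> real \<Rightarrow> real" where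
  "bound_step \<kappa> w b q p d =
     (if d = 0 then 0 else if b = 0 then max 0 (d - \<kappa>)
      else if d \<le> w then d + q else max (d + p - \<kappa>) (w + q))"

text \<open>\<open>x i\<close> holds the work and the patient work of customer \<open>i\<close>, and
  the partial sum of \<open>a\<close> is the number of the first customer of period
  \<open>k\<close>. Fixed input sequences keep arrivals and marks apart as two independent
  sources.\<close>

primrec bound_chain ::
    "real \<Rightarrow> real \<Rightarrow> (nat \<Rightarrow> nat) \<Rightarrow> (nat \<Rightarrow> real \<times> real) \<Rightarrow> nat \<Rightarrow> real" where
  "bound_chain \<kappa> w a x 0 = \<kappa>"
| "bound_chain \<kappa> w a x (Suc k) = bound_step \<kappa> w (a k)
     (\<Sum>i<a k. fst (x ((\<Sum>j<k. a j) + i))) (\<Sum>i<a k. snd (x ((\<Sum>j<k. a j) + i)))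
     (bound_chain \<kappa> w a x k)"

text \<open>The \<open>+ 1\<close> per live period makes the count diverge along a path that is
  never absorbed, matching the value \<infinity> of \<open>eta_star\<close>.\<close>

primrec bound_count ::
    "real \<Rightarrow> real \<Rightarrow> (nat \<Rightarrow> nat) \<Rightarrow> (nat \<Rightarrow> real \<times> real) \<Rightarrow> nat \<Rightarrow> nat" where
  "bound_count \<kappa> w a x 0 = 0"
| "bound_count \<kappa> w a x (Suc k) = bound_count \<kappa> w a x k
     + (if bound_chain \<kappa> w a x k = 0 then 0 else a k + 1)"

text \<open>Adaptedness: the state at period \<open>k\<close> sees only earlier periods and the
  marks of earlier customers. It justifies truncating the inputs in the independence
  argument.\<close>

lemma bound_chain_cong:
  assumes "\<And>j. j < k \<Longrightarrow> a j = a' j" "\<And>i. i < (\<Sum>j<k. a j) \<Longrightarrow> x i = x' i"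
  shows "bound_chain \<kappa> w a x k = bound_chain \<kappa> w a' x' k"
  using assms
proof (induction k)
  case (Suc k)
  have "(\<Sum>j<k. a j) = (\<Sum>j<k. a' j)" "a k = a' k"
    using Suc.prems by auto
  moreover have "bound_chain \<kappa> w a x k = bound_chain \<kappa> w a' x' k"
    using Suc.prems by (intro Suc.IH) auto
  moreover have "x ((\<Sum>j<k. a j) + i) = x' ((\<Sum>j<k. a j) + i)" if "i < a k" for i
    using Suc.prems that by simp
  ultimately show ?case by simp
qed simp

lemma bound_count_cong:
  assumes "\<And>j. j < k \<Longrightarrow> a j = a' j" "\<And>i. i < (\<Sum>j<k. a j) \<Longrightarrow> x i = x' i"
  shows "bound_count \<kappa> w a x k = bound_count \<kappa> w a' x' k"
  using assms
proof (induction k)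
  case (Suc k)
  have "bound_count \<kappa> w a x k = bound_count \<kappa> w a' x' k"
    using Suc.prems by (intro Suc.IH) auto
  moreover have "bound_chain \<kappa> w a x k = bound_chain \<kappa> w a' x' k"
    using Suc.prems by (intro bound_chain_cong) auto
  ultimately show ?case using Suc.prems by simp
qed simp

lemma bound_chain_nonneg:
  assumes "0 < \<kappa>" "0 \<le> w" "\<And>i. 0 \<le> fst (x i)"
  shows "0 \<le> bound_chain \<kappa> w a x k"
  using assms by (induction k) (auto simp: bound_step_def le_max_iff_disj intro!: add_nonneg_nonneg sum_nonneg)

lemma bound_count_mono: "j \<le> k \<Longrightarrow> bound_count \<kappa> w a x j \<le> bound_count \<kappa> w a x k"
  by (rule lift_Suc_mono_le[of "bound_count \<kappa> w a x"]) auto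

lemma bound_count_alive:
  assumes "\<And>j. j < k \<Longrightarrow> bound_chain \<kappa> w a x j \<noteq> 0"
  shows "bound_count \<kappa> w a x k = (\<Sum>j<k. a j) + k"
  using assms by (induction k) auto

text \<open>Induction over periods. The chain is stuck at 0 while the queue may fill up again, so
  the comparison is claimed only as long as all earlier states are nonzero.\<close>

lemma workload_le_bound_chain:
  fixes y :: "nat \<Rightarrow> ennreal"
  assumes n: "counting_path n" and \<kappa>: "0 < \<kappa>" and w0: "0 \<le> w0" and s: "\<And>i. 0 \<le> s i"
    and a: "\<And>k. a k = n (\<kappa> * real (Suc k)) - n (\<kappa> * real k)"
    and x: "\<And>i. x i = (s i, if ennreal w0 < y i then s i else 0)"
    and alive: "\<And>j. j < k \<Longrightarrow> bound_chain \<kappa> (w0 + \<kappa>) a x j \<noteq> 0"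
  shows "(\<Sum>j<k. a j) = n (\<kappa> * real k)"
    and "workload n s y (\<kappa> * real k) \<le> bound_chain \<kappa> (w0 + \<kappa>) a x k"
proof -
  have n0: "n 0 = 0" using n by (simp add: counting_path_def)
  have mono: "n (\<kappa> * real k) \<le> n (\<kappa> * real (Suc k))" for k
    using \<kappa> by (intro counting_path_mono[OF n]) auto
  have sum_a: "(\<Sum>j<k. a j) = n (\<kappa> * real k)" for k
  proof (induction k)
    case (Suc k)
    then show ?case using mono[of k] by (simp add: a)
  qed (simp add: n0)
  show "(\<Sum>j<k. a j) = n (\<kappa> * real k)" by (rule sum_a)
  show "workload n s y (\<kappa> * real k) \<le> bound_chain \<kappa> (w0 + \<kappa>) a x k"
    using alive
  proof (induction k)
    case 0
    then show ?case using \<kappa> n0 by (simp add: workload_def)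
  next
    case (Suc k)
    let ?t = "\<kappa> * real k" and ?t' = "\<kappa> * real (Suc k)"
    let ?W = "workload n s y ?t" and ?W' = "workload n s y ?t'"
    let ?D = "bound_chain \<kappa> (w0 + \<kappa>) a x k"
    define q p where "q = (\<Sum>i<a k. fst (x ((\<Sum>j<k. a j) + i)))"
      and "p = (\<Sum>i<a k. snd (x ((\<Sum>j<k. a j) + i)))"
    have shift: "(\<Sum>i<a k. f (n ?t + i)) = sum f {n ?t..<n ?t'}" for f :: "nat \<Rightarrow> real"
      using mono[of k] a[of k]
      by (intro sum.reindex_bij_witness[of _ "\<lambda>j. j - n ?t" "\<lambda>i. n ?t + i"]) auto
    have t: "0 \<le> ?t" "?t \<le> ?t'" and diff: "?t' - ?t = \<kappa>"
      using \<kappa> by (auto simp: algebra_simps)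
    have W: "?W \<le> ?D" using Suc by simp
    have D: "?D \<noteq> 0" using Suc.prems by simp
    have q: "q = (\<Sum>j\<in>{n ?t..<n ?t'}. s j)"
      unfolding q_def sum_a using shift[of s] by (simp add: x)
    have p: "p = (\<Sum>j\<in>{n ?t..<n ?t'}. if ennreal w0 < y j then s j else 0)"
      unfolding p_def sum_a using shift[of "\<lambda>j. if ennreal w0 < y j then s j else 0"] by (simp add: x)
    have all: "?W' \<le> ?W + q"
      unfolding q by (rule workload_le_sum[OF n t s])
    have high: "?W' \<le> ?W - \<kappa> + p" if "w0 + \<kappa> < ?W"
      using workload_high[OF n t s _ w0, where y = y] that unfolding diff p by simp
    have none: "?W' = max 0 (?W - \<kappa>)" if "a k = 0"
      using workload_no_arrivals[OF _ t(2), of n s y] that a[of k] mono[of k] unfolding diff by simp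
    \<comment> \<open>A workload above \<open>w0 + \<kappa>\<close> forces the bound above it too,
      and \<open>high\<close> gives the first entry of the maximum. A lower workload is covered by
      \<open>all\<close>, through \<open>d + q\<close> or \<open>w + q\<close>.\<close>
    have "?W' \<le> bound_step \<kappa> (w0 + \<kappa>) (a k) q p ?D"
      using all high none W D unfolding bound_step_def
      by (cases "w0 + \<kappa> < ?W") (auto simp: max_def)
    then show ?case by (simp add: q_def p_def)
  qed
qed

text \<open>Absorption of the chain at period \<open>K\<close> empties the queue at that grid point,
  so the first empty grid point comes no later and all arrivals up to \<open>K\<close> bound those
  who joined. Without absorption the right-hand side is infinite.\<close>

lemma eta_star_le_bound_count:
  fixes y :: "nat \<Rightarrow> ennreal"
  assumes n: "counting_path n" and \<kappa>: "0 < \<kappa>" and w0: "0 \<le> w0" and s: "\<And>i. 0 \<le> s i"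
    and a: "\<And>k. a k = n (\<kappa> * real (Suc k)) - n (\<kappa> * real k)"
    and x: "\<And>i. x i = (s i, if ennreal w0 < y i then s i else 0)"
  shows "eta_star \<kappa> n s y \<le> (SUP k. of_nat (bound_count \<kappa> (w0 + \<kappa>) a x k))"
proof -
  let ?D = "bound_chain \<kappa> (w0 + \<kappa>) a x" and ?C = "bound_count \<kappa> (w0 + \<kappa>) a x"
  show ?thesis
  proof (cases "\<exists>k. ?D k = 0")
    case True
    define K where "K = (LEAST k. ?D k = 0)"
    have K: "?D K = 0" unfolding K_def using True by (rule LeastI_ex)
    have alive: "?D j \<noteq> 0" if "j < K" for j
      using not_less_Least[of j "\<lambda>k. ?D k = 0"] that by (auto simp: K_def)
    \<comment> \<open>The chain starts in \<open>\<kappa> > 0\<close>, so absorption respects the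
      exclusion of grid point 0 in \<open>eta_star\<close>.\<close>
    have K1: "1 \<le> K" using K \<kappa> by (cases K) auto
    have "workload n s y (\<kappa> * real K) \<le> ?D K"
      by (rule workload_le_bound_chain(2)[OF n \<kappa> w0 s a x alive])
    then have zero: "1 \<le> K \<and> workload n s y (\<kappa> * real K) = 0"
      using K K1 workload_nonneg[of n s y "\<kappa> * real K"] by simp
    define T where "T = (LEAST k::nat. 1 \<le> k \<and> workload n s y (\<kappa> * real k) = 0)"
    have "T \<le> K" unfolding T_def using zero by (rule Least_le)
    have "njoined n s y (\<kappa> * real T) \<le> card {..<n (\<kappa> * real T)}"
      unfolding njoined_def by (intro card_mono) auto
    also have "\<dots> = n (\<kappa> * real T)" by simp
    also have "\<dots> \<le> n (\<kappa> * real K)"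
      using \<open>T \<le> K\<close> \<kappa> by (intro counting_path_mono[OF n]) auto
    also have "\<dots> = (\<Sum>j<K. a j)"
      by (rule workload_le_bound_chain(1)[OF n \<kappa> w0 s a x alive, symmetric])
    also have "\<dots> \<le> ?C K" using bound_count_alive[of K, OF alive] by simp
    finally have "eta_star \<kappa> n s y \<le> of_nat (?C K)"
      using zero unfolding eta_star_def T_def[symmetric] by auto
    also have "\<dots> \<le> (SUP k. of_nat (?C k))" by (rule SUP_upper) simp
    finally show ?thesis .
  next
    case False
    have "of_nat k \<le> (SUP k. of_nat (?C k) :: ennreal)" for k
    proof -
      have "k \<le> ?C k" using False bound_count_alive[of k \<kappa> "w0 + \<kappa>" a x] by simp
      then have "(of_nat k :: ennreal) \<le> of_nat (?C k)" by simp
      also have "\<dots> \<le> (SUP k. of_nat (?C k))" by (rule SUP_upper) simp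
      finally show ?thesis .
    qed
    then have "(SUP k. of_nat k :: ennreal) \<le> (SUP k. of_nat (?C k))"
      by (rule SUP_least)
    then have "(SUP k. of_nat (?C k) :: ennreal) = top"
      unfolding ennreal_SUP_of_nat_eq_top by (rule top.extremum_uniqueI)
    then show ?thesis by (metis top_greatest)
  qed
qed

section \<open>Binomial error bounds for perturbed powers\<close>

lemma power_add_le_first_order:
  fixes Z X :: real
  assumes "1 \<le> Z"
  shows "\<bar>(Z + X) ^ n - Z ^ n\<bar> * Z \<le> Z ^ n * ((1 + \<bar>X\<bar>) ^ n - 1)"
proof (induction n)
  case (Suc n)
  have eq: "(Z + X) ^ Suc n - Z ^ Suc n = (Z + X) * ((Z + X) ^ n - Z ^ n) + X * Z ^ n"
    by (simp add: algebra_simps)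
  have "\<bar>Z + X\<bar> \<le> Z * (1 + \<bar>X\<bar>)"
  proof -
    have "\<bar>X\<bar> \<le> Z * \<bar>X\<bar>" using assms mult_right_mono[of 1 Z "\<bar>X\<bar>"] by simp
    then show ?thesis using assms by (simp add: algebra_simps abs_le_iff)
  qed
  then have "\<bar>(Z + X) * ((Z + X) ^ n - Z ^ n)\<bar> * Z \<le> Z * (1 + \<bar>X\<bar>) * (\<bar>(Z + X) ^ n - Z ^ n\<bar> * Z)"
    using assms mult_right_mono[of "\<bar>Z + X\<bar>" "Z * (1 + \<bar>X\<bar>)" "\<bar>(Z + X) ^ n - Z ^ n\<bar> * Z"]
    by (simp add: abs_mult mult.assoc)
  also have "\<dots> \<le> Z * (1 + \<bar>X\<bar>) * (Z ^ n * ((1 + \<bar>X\<bar>) ^ n - 1))"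
    using Suc assms by (intro mult_left_mono) auto
  finally have 1: "\<bar>(Z + X) * ((Z + X) ^ n - Z ^ n)\<bar> * Z \<le> Z ^ Suc n * ((1 + \<bar>X\<bar>) ^ Suc n - 1 - \<bar>X\<bar>)"
    by (simp add: algebra_simps)
  have 2: "\<bar>X * Z ^ n\<bar> * Z = Z ^ Suc n * \<bar>X\<bar>" using assms by (simp add: abs_mult)
  have "\<bar>(Z + X) ^ Suc n - Z ^ Suc n\<bar> * Z \<le> (\<bar>(Z + X) * ((Z + X) ^ n - Z ^ n)\<bar> + \<bar>X * Z ^ n\<bar>) * Z"
    unfolding eq using assms by (intro mult_right_mono abs_triangle_ineq) auto
  also have "\<dots> = \<bar>(Z + X) * ((Z + X) ^ n - Z ^ n)\<bar> * Z + Z ^ Suc n * \<bar>X\<bar>"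
    by (simp only: distrib_right 2)
  also have "\<dots> \<le> Z ^ Suc n * ((1 + \<bar>X\<bar>) ^ Suc n - 1)"
    using 1 by (simp add: right_diff_distrib)
  finally show ?case .
qed simp

text \<open>In the binomial expansion every term of degree at least 2 in \<open>X\<close> carries at
  most the power n - 1 of \<open>Z\<close>, because \<open>1 \<le> Z\<close>; the remaining
  coefficients add up to the same expansion at Z = 1. The first-order bound works alike with degree
  at least 1. The factor \<open>Z\<close> on the left avoids the exponent n - 1.\<close>

lemma power_add_le_second_order:
  fixes Z X :: real
  assumes "1 \<le> Z"
  shows "\<bar>(Z + X) ^ Suc n - Z ^ Suc n - real (Suc n) * Z ^ n * X\<bar> * Z
    \<le> Z ^ n * ((1 + \<bar>X\<bar>) ^ Suc n - 1 - real (Suc n) * \<bar>X\<bar>)"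
proof (induction n)
  case (Suc n)
  define r where "r = (Z + X) ^ Suc n - Z ^ Suc n - real (Suc n) * Z ^ n * X"
  define g where "g = (1 + \<bar>X\<bar>) ^ Suc n - 1 - real (Suc n) * \<bar>X\<bar>"
  have XX: "X * X = \<bar>X\<bar> * \<bar>X\<bar>" by simp
  have eq: "(Z + X) ^ Suc (Suc n) - Z ^ Suc (Suc n) - real (Suc (Suc n)) * Z ^ Suc n * X
      = (Z + X) * r + real (Suc n) * Z ^ n * (X * X)"
    unfolding r_def by (simp add: algebra_simps)
  have g: "(1 + \<bar>X\<bar>) ^ Suc (Suc n) - 1 - real (Suc (Suc n)) * \<bar>X\<bar>
      = (1 + \<bar>X\<bar>) * g + real (Suc n) * (X * X)"
    unfolding g_def XX by (simp add: algebra_simps del: abs_mult_self_eq)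
  have "\<bar>Z + X\<bar> \<le> Z * (1 + \<bar>X\<bar>)"
  proof -
    have "\<bar>X\<bar> \<le> Z * \<bar>X\<bar>" using assms mult_right_mono[of 1 Z "\<bar>X\<bar>"] by simp
    then show ?thesis using assms by (simp add: algebra_simps abs_le_iff)
  qed
  then have "\<bar>(Z + X) * r\<bar> * Z \<le> Z * (1 + \<bar>X\<bar>) * (\<bar>r\<bar> * Z)"
    using assms mult_right_mono[of "\<bar>Z + X\<bar>" "Z * (1 + \<bar>X\<bar>)" "\<bar>r\<bar> * Z"]
    by (simp add: abs_mult mult.assoc)
  also have "\<dots> \<le> Z * (1 + \<bar>X\<bar>) * (Z ^ n * g)"
    using Suc assms unfolding r_def g_def by (intro mult_left_mono) auto
  finally have 1: "\<bar>(Z + X) * r\<bar> * Z \<le> Z ^ Suc n * ((1 + \<bar>X\<bar>) * g)"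
    by (simp add: algebra_simps)
  have 2: "\<bar>real (Suc n) * Z ^ n * (X * X)\<bar> * Z = Z ^ Suc n * (real (Suc n) * (X * X))"
    using assms by (simp add: abs_mult)
  have "\<bar>(Z + X) * r + real (Suc n) * Z ^ n * (X * X)\<bar> * Z
      \<le> (\<bar>(Z + X) * r\<bar> + \<bar>real (Suc n) * Z ^ n * (X * X)\<bar>) * Z"
    using assms by (intro mult_right_mono abs_triangle_ineq) auto
  also have "\<dots> = \<bar>(Z + X) * r\<bar> * Z + Z ^ Suc n * (real (Suc n) * (X * X))"
    by (simp only: distrib_right 2)
  also have "\<dots> \<le> Z ^ Suc n * ((1 + \<bar>X\<bar>) * g + real (Suc n) * (X * X))"
    using 1 by (simp add: distrib_left)
  finally show ?case unfolding eq g .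
qed simp

section \<open>A Lyapunov function for the dominating chain\<close>

text \<open>The weight drops by enough along \<open>\<kappa>\<close>-steps towards 0 that, on a low level, a period without
arrivals (probability at least \<open>2 * r\<close>) compensates a possible positive drift.\<close>

definition level_weight :: "real \<Rightarrow> nat \<Rightarrow> real \<Rightarrow> real \<Rightarrow> real" where
  "level_weight r J \<kappa> d = 2 - r ^ min J (nat \<lceil>d / \<kappa>\<rceil>)"

lemma level_weight_bounds:
  assumes "0 < r" "r \<le> 1"
  shows "1 \<le> level_weight r J \<kappa> d" "level_weight r J \<kappa> d \<le> 2 - r ^ J"
proof -
  show "1 \<le> level_weight r J \<kappa> d"
    using assms by (simp add: level_weight_def power_le_one)
  have "r ^ J \<le> r ^ min J (nat \<lceil>d / \<kappa>\<rceil>)" using assms by (intro power_decreasing) auto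
  then show "level_weight r J \<kappa> d \<le> 2 - r ^ J"
    using assms by (auto simp: level_weight_def)
qed

lemma level_weight_high:
  assumes "0 < \<kappa>" "\<kappa> * real J < d"
  shows "level_weight r J \<kappa> d = 2 - r ^ J"
proof -
  have "real J \<le> d / \<kappa>" using assms by (simp add: field_simps)
  then have "J \<le> nat \<lceil>d / \<kappa>\<rceil>" by linarith
  then show ?thesis by (simp add: level_weight_def min_def)
qed

text \<open>The ceiling counts the \<open>\<kappa>\<close>-steps still needed to reach 0, so a step
  without arrivals lowers it by exactly one, including the last, truncated step.\<close>

lemma level_weight_low:
  assumes "0 < \<kappa>" "0 < d" "d \<le> \<kappa> * real J"
  shows "0 < nat \<lceil>d / \<kappa>\<rceil>" "nat \<lceil>d / \<kappa>\<rceil> \<le> J"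
    "level_weight r J \<kappa> d = 2 - r ^ nat \<lceil>d / \<kappa>\<rceil>"
    "level_weight r J \<kappa> (max 0 (d - \<kappa>)) = 2 - r ^ (nat \<lceil>d / \<kappa>\<rceil> - 1)"
proof -
  have pos: "0 < d / \<kappa>" and le: "d / \<kappa> \<le> real J"
    using assms by (auto simp: field_simps)
  show 1: "0 < nat \<lceil>d / \<kappa>\<rceil>" using pos by simp
  show 2: "nat \<lceil>d / \<kappa>\<rceil> \<le> J" using le by linarith
  then show "level_weight r J \<kappa> d = 2 - r ^ nat \<lceil>d / \<kappa>\<rceil>" by (simp add: level_weight_def)
  have "nat \<lceil>max 0 (d - \<kappa>) / \<kappa>\<rceil> = nat \<lceil>d / \<kappa>\<rceil> - 1"
  proof (cases "d \<le> \<kappa>")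
    case True
    then have "d / \<kappa> \<le> 1" using assms by simp
    then have "nat \<lceil>d / \<kappa>\<rceil> \<le> 1" by linarith
    then show ?thesis using True by simp
  next
    case False
    then have "max 0 (d - \<kappa>) / \<kappa> = d / \<kappa> - 1"
      using assms by (simp add: max_def diff_divide_distrib)
    then show ?thesis by simp
  qed
  moreover have "min J (nat \<lceil>d / \<kappa>\<rceil> - 1) = nat \<lceil>d / \<kappa>\<rceil> - 1" using 2 by linarith
  ultimately show "level_weight r J \<kappa> (max 0 (d - \<kappa>)) = 2 - r ^ (nat \<lceil>d / \<kappa>\<rceil> - 1)"
    by (simp only: level_weight_def)
qed

definition lyapunov ::
    "nat \<Rightarrow> real \<Rightarrow> real \<Rightarrow> real \<Rightarrow> nat \<Rightarrow> real \<Rightarrow> nat \<Rightarrow> real \<Rightarrow> real" where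
  "lyapunov n z \<epsilon> r J \<kappa> c d = (z + \<epsilon> * real c + d) ^ Suc n * level_weight r J \<kappa> d"

text \<open>The power is bounded crudely: its growth is at most \<open>Z ^ n * T\<close>, and a
  weight of at most 2 doubles this. The gain lies in the weight: it is at most
  \<open>2 - r ^ J\<close>, and without arrivals it is \<open>2 - r ^ (j - 1)\<close>. That
  difference stands on the left as a bonus.\<close>

lemma lyapunov_step_low:
  fixes q p :: real and b c n :: nat
  assumes par: "0 < \<kappa>" "0 \<le> w" "0 < \<epsilon>" "\<epsilon> \<le> 1" "1 \<le> z" "0 < r" "r \<le> 1"
    and d: "0 < d" "d \<le> \<kappa> * real J" and qp: "0 \<le> p" "p \<le> q"
  defines "Z \<equiv> z + \<epsilon> * real c + d"
    and "T \<equiv> (2 + \<kappa> + real b + 2 * q) ^ Suc n" and "j \<equiv> nat \<lceil>d / \<kappa>\<rceil>"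
  shows "lyapunov n z \<epsilon> r J \<kappa> (c + b + 1) (bound_step \<kappa> w b q p d)
      + Z ^ Suc n * (r ^ (j - 1) - r ^ J) * (if b = 0 then 1 else 0)
    \<le> Z ^ Suc n * (2 - r ^ J) + 2 * Z ^ n * T"
proof -
  define d' where "d' = bound_step \<kappa> w b q p d"
  define Z' where "Z' = z + \<epsilon> * real (c + b + 1) + d'"
  \<comment> \<open>The increment of the argument is at most \<open>q + b + 1\<close>. The larger
    value gives the same \<open>T\<close> as the high case, where \<open>p + e\<close> needs
    \<open>2 * q\<close> and the negative drift needs \<open>\<kappa>\<close>.\<close>
  define X where "X = 1 + \<kappa> + real b + 2 * q"
  have q: "0 \<le> q" using qp by simp
  have X: "0 \<le> X" using par q by (simp add: X_def)
  have Z1: "1 \<le> Z" unfolding Z_def using par d by (simp add: add_increasing2)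
  have d'0: "0 \<le> d'" unfolding d'_def bound_step_def using par d q by auto
  have d'd: "d' \<le> d + q"
    unfolding d'_def bound_step_def using par d qp by (auto simp: max_def)
  have "\<epsilon> * real (b + 1) \<le> 1 * real (b + 1)" using par by (intro mult_right_mono) auto
  then have Z'le: "Z' \<le> Z + X"
    unfolding Z'_def Z_def X_def using d'd par q by (simp add: algebra_simps)
  have Z'0: "0 \<le> Z'" unfolding Z'_def using par d'0 by simp
  have "\<bar>(Z + X) ^ Suc n - Z ^ Suc n\<bar> * Z \<le> Z ^ Suc n * ((1 + \<bar>X\<bar>) ^ Suc n - 1)"
    by (rule power_add_le_first_order[OF Z1])
  also have "\<dots> \<le> Z ^ Suc n * T"
    unfolding T_def using X Z1 by (intro mult_left_mono) (auto simp: X_def algebra_simps)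
  finally have "\<bar>(Z + X) ^ Suc n - Z ^ Suc n\<bar> * Z \<le> (Z ^ n * T) * Z" by (simp add: algebra_simps)
  then have "\<bar>(Z + X) ^ Suc n - Z ^ Suc n\<bar> \<le> Z ^ n * T"
    using Z1 mult_right_le_imp_le[of "\<bar>(Z + X) ^ Suc n - Z ^ Suc n\<bar>" Z "Z ^ n * T"] by linarith
  then have "(Z + X) ^ Suc n \<le> Z ^ Suc n + Z ^ n * T" by linarith
  moreover have "Z' ^ Suc n \<le> (Z + X) ^ Suc n" using Z'le Z'0 by (intro power_mono) auto
  ultimately have pow: "Z' ^ Suc n \<le> Z ^ Suc n + Z ^ n * T" by linarith
  have T0: "0 \<le> Z ^ n * T" "0 \<le> Z ^ Suc n" using X Z1 by (auto simp: T_def X_def)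
  have rJ: "0 \<le> r ^ J" "0 \<le> r ^ (j - 1)" using par by auto
  \<comment> \<open>Bound on the weight after the step, with the bonus for an empty period built
    in.\<close>
  define v where "v = 2 - r ^ J - (r ^ (j - 1) - r ^ J) * (if b = 0 then 1 else 0)"
  have lw: "level_weight r J \<kappa> d' \<le> v"
    using level_weight_low(4)[OF par(1) d, of r] level_weight_bounds(2)[OF par(6,7), of J \<kappa> d'] d
    by (auto simp: v_def j_def d'_def bound_step_def)
  have v: "v \<le> 2" "0 \<le> v"
    using rJ level_weight_bounds(1)[OF par(6,7), of J \<kappa> d'] lw by (auto simp: v_def)
  have "lyapunov n z \<epsilon> r J \<kappa> (c + b + 1) d' = Z' ^ Suc n * level_weight r J \<kappa> d'"
    by (simp add: lyapunov_def Z'_def)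
  also have "\<dots> \<le> (Z ^ Suc n + Z ^ n * T) * v"
    using pow lw Z'0 T0 level_weight_bounds(1)[OF par(6,7), of J \<kappa> d'] by (intro mult_mono) auto
  also have "\<dots> \<le> Z ^ Suc n * v + Z ^ n * T * 2"
    using mult_left_mono[OF v(1) T0(1)] by (simp only: distrib_right)
  finally show ?thesis unfolding d'_def[symmetric] v_def by (simp add: algebra_simps)
qed

text \<open>Above \<open>\<kappa> * real J\<close> the weight is at its maximum and can only fall,
  so only the power matters. Its argument moves by at most \<open>R - \<kappa>\<close>. The term
  with \<open>\<kappa>\<close> stands on the left so that all random quantities are nonnegative when
  expectations are taken in \<open>ennreal\<close>.\<close>

lemma lyapunov_step_high:
  fixes q p :: real and b c n :: nat
  assumes par: "0 < \<kappa>" "0 \<le> w" "0 < \<epsilon>" "\<epsilon> \<le> 1" "1 \<le> z" "0 < r" "r \<le> 1" "1 \<le> J" "w \<le> \<kappa> * real J"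
    and d: "\<kappa> * real J < d" and qp: "0 \<le> p" "p \<le> q"
    and e: "0 \<le> e" "e \<le> q" "q - (\<kappa> * real J - w - \<kappa>) \<le> e"
  defines "Z \<equiv> z + \<epsilon> * real c + d"
    and "T \<equiv> (2 + \<kappa> + real b + 2 * q) ^ Suc n"
    and "R \<equiv> p + e + \<epsilon> * real (b + 1)"
  shows "lyapunov n z \<epsilon> r J \<kappa> (c + b + 1) (bound_step \<kappa> w b q p d)
      + (2 - r ^ J) * real (Suc n) * Z ^ n * \<kappa>
    \<le> (2 - r ^ J) * (Z ^ Suc n + real (Suc n) * Z ^ n * R + Z ^ n / Z * T)"
proof -
  define d' where "d' = bound_step \<kappa> w b q p d"
  define Z' where "Z' = z + \<epsilon> * real (c + b + 1) + d'"
  define X where "X = R - \<kappa>"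
  have q: "0 \<le> q" using qp by simp
  have \<kappa>J: "\<kappa> \<le> \<kappa> * real J" using par mult_left_mono[of 1 "real J" \<kappa>] by simp
  have dpos: "0 < d" "\<kappa> < d" using \<kappa>J d par by linarith+
  have Z1: "1 \<le> Z" unfolding Z_def using par dpos by (simp add: add_increasing2)
  have d'0: "0 \<le> d'" unfolding d'_def bound_step_def using par d q dpos by auto
  \<comment> \<open>The excess \<open>e\<close> absorbs the branch \<open>w + q\<close>: since
    \<open>d\<close> exceeds \<open>\<kappa> * real J\<close>, the third condition on
    \<open>e\<close> gives \<open>w + q \<le> d - \<kappa> + e\<close>.\<close>
  have d'd: "d' \<le> d - \<kappa> + p + e"
    unfolding d'_def bound_step_def using par d qp e dpos by (auto simp: max_def)
  have "\<epsilon> * real (b + 1) \<le> 1 * real (b + 1)" using par by (intro mult_right_mono) auto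
  then have \<epsilon>b: "\<epsilon> * real (b + 1) \<le> real b + 1"
    by (simp only: of_nat_add of_nat_1 mult_1)
  have \<epsilon>b0: "0 \<le> \<epsilon> * real (b + 1)" using par by simp
  have Z'le: "Z' \<le> Z + X"
    unfolding Z'_def Z_def X_def R_def using d'd by (simp add: algebra_simps)
  have Z'0: "0 \<le> Z'" unfolding Z'_def using par d'0 by simp
  have absX: "\<bar>X\<bar> \<le> 1 + \<kappa> + real b + 2 * q"
    unfolding X_def R_def using \<epsilon>b \<epsilon>b0 qp e par(1) by linarith
  have "\<bar>(Z + X) ^ Suc n - Z ^ Suc n - real (Suc n) * Z ^ n * X\<bar> * Z
      \<le> Z ^ n * ((1 + \<bar>X\<bar>) ^ Suc n - 1 - real (Suc n) * \<bar>X\<bar>)"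
    by (rule power_add_le_second_order[OF Z1])
  also have "\<dots> \<le> Z ^ n * T"
  proof (rule mult_left_mono)
    have "(1 + \<bar>X\<bar>) ^ Suc n \<le> T"
      unfolding T_def using absX by (intro power_mono) auto
    moreover have "0 \<le> real (Suc n) * \<bar>X\<bar>" by simp
    ultimately show "(1 + \<bar>X\<bar>) ^ Suc n - 1 - real (Suc n) * \<bar>X\<bar> \<le> T" by linarith
  qed (use Z1 in simp)
  finally have "\<bar>(Z + X) ^ Suc n - Z ^ Suc n - real (Suc n) * Z ^ n * X\<bar> \<le> Z ^ n / Z * T"
    using Z1 by (simp add: field_simps)
  moreover have "Z' ^ Suc n \<le> (Z + X) ^ Suc n" using Z'le Z'0 by (intro power_mono) auto
  ultimately have pow: "Z' ^ Suc n \<le> Z ^ Suc n + real (Suc n) * Z ^ n * X + Z ^ n / Z * T"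
    by linarith
  have "lyapunov n z \<epsilon> r J \<kappa> (c + b + 1) d' = level_weight r J \<kappa> d' * Z' ^ Suc n"
    by (simp add: lyapunov_def Z'_def)
  also have "\<dots> \<le> (2 - r ^ J) * Z' ^ Suc n"
    using level_weight_bounds(2)[OF par(6,7)] Z'0 by (intro mult_right_mono) auto
  also have "\<dots> \<le> (2 - r ^ J) * (Z ^ Suc n + real (Suc n) * Z ^ n * X + Z ^ n / Z * T)"
    using pow par power_le_one[of r J] by (intro mult_left_mono) auto
  finally show ?thesis unfolding d'_def[symmetric] X_def by (simp add: algebra_simps)
qed

section \<open>Independence of differently typed random variables\<close>

text \<open>An intersection-stable generator of the sigma-algebra of the pair \<open>(f, g)\<close>,
  so that independence of pairs need only be checked on rectangles.\<close>

definition rect_events ::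
    "'a measure \<Rightarrow> 'b measure \<Rightarrow> 'c measure \<Rightarrow> ('a \<Rightarrow> 'b) \<Rightarrow> ('a \<Rightarrow> 'c) \<Rightarrow> 'a set set" where
  "rect_events M S T f g =
     {(f -` P \<inter> space M) \<inter> (g -` Q \<inter> space M) |P Q. P \<in> sets S \<and> Q \<in> sets T}"

lemma rect_events_subset: "rect_events M S T f g \<subseteq> Pow (space M)"
  unfolding rect_events_def by auto

lemma vimage_pair_eq_sigma_rect_events:
  assumes "f \<in> measurable M S" "g \<in> measurable M T"
  shows "{(\<lambda>\<omega>. (f \<omega>, g \<omega>)) -` C \<inter> space M |C. C \<in> sets (S \<Otimes>\<^sub>M T)}
    = sigma_sets (space M) (rect_events M S T f g)"
proof -
  have "(\<lambda>\<omega>. (f \<omega>, g \<omega>)) -` (P \<times> Q) \<inter> space M = (f -` P \<inter> space M) \<inter> (g -` Q \<inter> space M)" for P Q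
    by auto
  then have "rect_events M S T f g = {(\<lambda>\<omega>. (f \<omega>, g \<omega>)) -` C \<inter> space M |C.
      C \<in> {P \<times> Q |P Q. P \<in> sets S \<and> Q \<in> sets T}}"
    unfolding rect_events_def by (auto; metis)
  then show ?thesis
    unfolding sets_pair_measure
    by (simp only:) (rule sigma_sets_vimage_commute, use assms in \<open>auto dest: measurable_space\<close>)
qed

lemma Int_stable_rect_events: "Int_stable (rect_events M S T f g)"
proof (rule Int_stableI)
  fix E F assume "E \<in> rect_events M S T f g" "F \<in> rect_events M S T f g"
  then obtain P Q P' Q' where *: "P \<in> sets S" "Q \<in> sets T" "P' \<in> sets S" "Q' \<in> sets T"
    and EF: "E = (f -` P \<inter> space M) \<inter> (g -` Q \<inter> space M)" "F = (f -` P' \<inter> space M) \<inter> (g -` Q' \<inter> space M)"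
    unfolding rect_events_def by blast
  have "E \<inter> F = (f -` (P \<inter> P') \<inter> space M) \<inter> (g -` (Q \<inter> Q') \<inter> space M)"
    unfolding EF by auto
  then show "E \<inter> F \<in> rect_events M S T f g"
    unfolding rect_events_def using * by blast
qed

text \<open>The library's \<open>indep_var\<close> forces both variables to have the same type.\<close>

definition (in prob_space) indep_pair ::
    "'b measure \<Rightarrow> ('a \<Rightarrow> 'b) \<Rightarrow> 'c measure \<Rightarrow> ('a \<Rightarrow> 'c) \<Rightarrow> bool" where
  "indep_pair S X T Y \<longleftrightarrow> X \<in> measurable M S \<and> Y \<in> measurable M T \<and>
     indep_set {X -` P \<inter> space M |P. P \<in> sets S} {Y -` Q \<inter> space M |Q. Q \<in> sets T}"

lemma (in prob_space) indep_pairD: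
  assumes "indep_pair S X T Y" "P \<in> sets S" "Q \<in> sets T"
  shows "prob ((X -` P \<inter> space M) \<inter> (Y -` Q \<inter> space M)) = prob (X -` P \<inter> space M) * prob (Y -` Q \<inter> space M)"
  using assms unfolding indep_pair_def indep_sets2_eq by blast

lemma (in prob_space) indep_pair_rv1: "indep_pair S X T Y \<Longrightarrow> X \<in> measurable M S"
  and indep_pair_rv2: "indep_pair S X T Y \<Longrightarrow> Y \<in> measurable M T"
  by (auto simp: indep_pair_def)

lemma (in prob_space) indep_var_imp_indep_pair:
  assumes "indep_var S X T Y"
  shows "indep_pair S X T Y"
proof -
  have "indep_set (sigma_sets (space M) {X -` P \<inter> space M |P. P \<in> sets S})
      (sigma_sets (space M) {Y -` Q \<inter> space M |Q. Q \<in> sets T})"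
    using assms by (simp add: indep_var_eq)
  then have "indep_set {X -` P \<inter> space M |P. P \<in> sets S} {Y -` Q \<inter> space M |Q. Q \<in> sets T}"
    unfolding indep_sets2_eq by (blast intro: sigma_sets.Basic)
  then show ?thesis
    using assms by (auto simp: indep_pair_def dest: indep_var_rv1 indep_var_rv2)
qed

lemma (in prob_space) indep_pair_compose:
  assumes XY: "indep_pair S X T Y" and f: "f \<in> measurable S S'" and g: "g \<in> measurable T T'"
  shows "indep_pair S' (\<lambda>\<omega>. f (X \<omega>)) T' (\<lambda>\<omega>. g (Y \<omega>))"
proof -
  note rv = indep_pair_rv1[OF XY] indep_pair_rv2[OF XY]
  have eq: "(\<lambda>\<omega>. f (X \<omega>)) -` P \<inter> space M = X -` (f -` P \<inter> space S) \<inter> space M"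
    "(\<lambda>\<omega>. g (Y \<omega>)) -` Q \<inter> space M = Y -` (g -` Q \<inter> space T) \<inter> space M" for P Q
    using rv[THEN measurable_space] by auto
  have "{(\<lambda>\<omega>. f (X \<omega>)) -` P \<inter> space M |P. P \<in> sets S'} \<subseteq> {X -` P \<inter> space M |P. P \<in> sets S}"
    using eq(1) measurable_sets[OF f] by blast
  moreover have "{(\<lambda>\<omega>. g (Y \<omega>)) -` Q \<inter> space M |Q. Q \<in> sets T'} \<subseteq> {Y -` Q \<inter> space M |Q. Q \<in> sets T}"
    using eq(2) measurable_sets[OF g] by blast
  ultimately show ?thesis
    using XY measurable_compose[OF rv(1) f] measurable_compose[OF rv(2) g]
    unfolding indep_pair_def indep_sets2_eq by (meson subset_trans subsetD)
qed

text \<open>The hypotheses make all four variables independent, which allows regrouping: for past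
  and future of arrivals (a) and marks (b), the joint past is independent of the joint future. On
  rectangles the probability factors fourfold; inserting whole spaces yields the probability of each
  pair.\<close>

lemma (in prob_space) indep_pair_pairs:
  assumes a: "indep_pair A1 a1 A2 a2" and b: "indep_pair B1 b1 B2 b2"
    and ab: "indep_pair (A1 \<Otimes>\<^sub>M A2) (\<lambda>\<omega>. (a1 \<omega>, a2 \<omega>)) (B1 \<Otimes>\<^sub>M B2) (\<lambda>\<omega>. (b1 \<omega>, b2 \<omega>))"
  shows "indep_pair (A1 \<Otimes>\<^sub>M B1) (\<lambda>\<omega>. (a1 \<omega>, b1 \<omega>)) (A2 \<Otimes>\<^sub>M B2) (\<lambda>\<omega>. (a2 \<omega>, b2 \<omega>))"
proof -
  note rv = indep_pair_rv1[OF a] indep_pair_rv2[OF a] indep_pair_rv1[OF b] indep_pair_rv2[OF b]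
  note [measurable] = rv
  note sp = rv[THEN measurable_space]
  have "indep_set (rect_events M A1 B1 a1 b1) (rect_events M A2 B2 a2 b2)"
  proof (rule indep_setI)
    show "rect_events M A1 B1 a1 b1 \<subseteq> events" "rect_events M A2 B2 a2 b2 \<subseteq> events"
      unfolding rect_events_def by auto
  next
    fix E F assume "E \<in> rect_events M A1 B1 a1 b1" "F \<in> rect_events M A2 B2 a2 b2"
    then obtain P Q P' Q' where *[measurable]: "P \<in> sets A1" "Q \<in> sets B1" "P' \<in> sets A2" "Q' \<in> sets B2"
      and EF: "E = (a1 -` P \<inter> space M) \<inter> (b1 -` Q \<inter> space M)" "F = (a2 -` P' \<inter> space M) \<inter> (b2 -` Q' \<inter> space M)"
      unfolding rect_events_def by blast
    have split: "prob (((a1 -` P \<inter> space M) \<inter> (a2 -` P' \<inter> space M)) \<inter> ((b1 -` Q \<inter> space M) \<inter> (b2 -` Q' \<inter> space M)))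
      = prob (a1 -` P \<inter> space M) * prob (a2 -` P' \<inter> space M) * (prob (b1 -` Q \<inter> space M) * prob (b2 -` Q' \<inter> space M))"
      if "P \<in> sets A1" "Q \<in> sets B1" "P' \<in> sets A2" "Q' \<in> sets B2" for P Q P' Q'
    proof -
      have eq: "(\<lambda>\<omega>. (a1 \<omega>, a2 \<omega>)) -` (P \<times> P') \<inter> space M = (a1 -` P \<inter> space M) \<inter> (a2 -` P' \<inter> space M)"
        "(\<lambda>\<omega>. (b1 \<omega>, b2 \<omega>)) -` (Q \<times> Q') \<inter> space M = (b1 -` Q \<inter> space M) \<inter> (b2 -` Q' \<inter> space M)"
        by auto
      have "P \<times> P' \<in> sets (A1 \<Otimes>\<^sub>M A2)" "Q \<times> Q' \<in> sets (B1 \<Otimes>\<^sub>M B2)" using that by auto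
      from indep_pairD[OF ab this] show ?thesis
        unfolding eq indep_pairD[OF a that(1,3)] indep_pairD[OF b that(2,4)] .
    qed
    have 1: "prob E = prob (a1 -` P \<inter> space M) * prob (b1 -` Q \<inter> space M)"
    proof -
      have "prob (a2 -` space A2 \<inter> space M) = 1" "prob (b2 -` space B2 \<inter> space M) = 1"
        using sp by (auto intro!: prob_eq_1[THEN iffD2] AE_I2)
      moreover have "E = ((a1 -` P \<inter> space M) \<inter> (a2 -` space A2 \<inter> space M)) \<inter> ((b1 -` Q \<inter> space M) \<inter> (b2 -` space B2 \<inter> space M))"
        unfolding EF using sp by auto
      ultimately show ?thesis using split[OF *(1,2) sets.top sets.top] by simp
    qed
    have 2: "prob F = prob (a2 -` P' \<inter> space M) * prob (b2 -` Q' \<inter> space M)"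
    proof -
      have "prob (a1 -` space A1 \<inter> space M) = 1" "prob (b1 -` space B1 \<inter> space M) = 1"
        using sp by (auto intro!: prob_eq_1[THEN iffD2] AE_I2)
      moreover have "F = ((a1 -` space A1 \<inter> space M) \<inter> (a2 -` P' \<inter> space M)) \<inter> ((b1 -` space B1 \<inter> space M) \<inter> (b2 -` Q' \<inter> space M))"
        unfolding EF using sp by auto
      ultimately show ?thesis using split[OF sets.top sets.top *(3,4)] by simp
    qed
    have "E \<inter> F = ((a1 -` P \<inter> space M) \<inter> (a2 -` P' \<inter> space M)) \<inter> ((b1 -` Q \<inter> space M) \<inter> (b2 -` Q' \<inter> space M))"
      unfolding EF by auto
    then show "prob (E \<inter> F) = prob E * prob F"
      using split[OF *] 1 2 by simp
  qed
  then have "indep_set (sigma_sets (space M) (rect_events M A1 B1 a1 b1)) (sigma_sets (space M) (rect_events M A2 B2 a2 b2))"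
    by (rule indep_set_sigma_sets) (rule Int_stable_rect_events)+
  then show ?thesis
    unfolding indep_pair_def
    by (simp add: vimage_pair_eq_sigma_rect_events rv sigma_sets_sigma_sets_eq[OF rect_events_subset])
qed

text \<open>The joint law is the product law, so Tonelli applies. The inner variable
  \<open>\<omega>'\<close> acts as an independent copy, which amounts to conditioning on
  \<open>X\<close>.\<close>

lemma (in prob_space) nn_integral_indep_pair:
  assumes ind: "indep_pair S X T Y" and h: "h \<in> borel_measurable (S \<Otimes>\<^sub>M T)"
  shows "(\<integral>\<^sup>+ \<omega>. h (X \<omega>, Y \<omega>) \<partial>M) = (\<integral>\<^sup>+ \<omega>. (\<integral>\<^sup>+ \<omega>'. h (X \<omega>, Y \<omega>') \<partial>M) \<partial>M)"
proof -
  note [measurable] = indep_pair_rv1[OF ind] indep_pair_rv2[OF ind] h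
  interpret T: prob_space "distr M T Y" by (rule prob_space_distr) measurable
  have eq: "distr M S X \<Otimes>\<^sub>M distr M T Y = distr M (S \<Otimes>\<^sub>M T) (\<lambda>\<omega>. (X \<omega>, Y \<omega>))"
  proof (rule pair_measure_eqI)
    show "sigma_finite_measure (distr M S X)"
      by (rule prob_space_imp_sigma_finite, rule prob_space_distr) measurable
    show "sigma_finite_measure (distr M T Y)" by unfold_locales
    fix P Q assume "P \<in> sets (distr M S X)" "Q \<in> sets (distr M T Y)"
    then have PQ[measurable]: "P \<in> sets S" "Q \<in> sets T" by auto
    have "(\<lambda>\<omega>. (X \<omega>, Y \<omega>)) -` (P \<times> Q) \<inter> space M = (X -` P \<inter> space M) \<inter> (Y -` Q \<inter> space M)"
      by auto
    then show "emeasure (distr M S X) P * emeasure (distr M T Y) Q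
        = emeasure (distr M (S \<Otimes>\<^sub>M T) (\<lambda>\<omega>. (X \<omega>, Y \<omega>))) (P \<times> Q)"
      using indep_pairD[OF ind PQ]
      by (simp add: emeasure_distr emeasure_eq_measure ennreal_mult)
  qed simp
  have "(\<integral>\<^sup>+ \<omega>. h (X \<omega>, Y \<omega>) \<partial>M) = (\<integral>\<^sup>+ z. h z \<partial>(distr M S X \<Otimes>\<^sub>M distr M T Y))"
    unfolding eq by (subst nn_integral_distr) auto
  also have "\<dots> = (\<integral>\<^sup>+ x. \<integral>\<^sup>+ y. h (x, y) \<partial>distr M T Y \<partial>distr M S X)"
    by (rule T.nn_integral_fst[symmetric]) measurable
  also have "\<dots> = (\<integral>\<^sup>+ \<omega>. (\<integral>\<^sup>+ y. h (X \<omega>, y) \<partial>distr M T Y) \<partial>M)"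
    by (subst nn_integral_distr) auto
  also have "\<dots> = (\<integral>\<^sup>+ \<omega>. (\<integral>\<^sup>+ \<omega>'. h (X \<omega>, Y \<omega>') \<partial>M) \<partial>M)"
    by (intro nn_integral_cong nn_integral_distr measurable_compose[OF _ h] measurable_Pair1')
       (auto dest: measurable_space[OF indep_pair_rv1[OF ind]])
  finally show ?thesis .
qed

section \<open>Marked Poisson blocks\<close>

text \<open>\<open>A k\<close> is the number of arrivals in period \<open>k\<close>, and
  \<open>X i\<close> the work and patient work of customer \<open>i\<close>. Rates may differ
  between periods; the estimates see them only through the common bound \<open>\<mu>'\<close> on the
  Poisson means.\<close>

locale marked_blocks = prob_space M for M :: "'a measure" +
  fixes A :: "nat \<Rightarrow> 'a \<Rightarrow> nat" and X :: "nat \<Rightarrow> 'a \<Rightarrow> real \<times> real"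
    and \<mu> :: "nat \<Rightarrow> real" and \<mu>' :: real
  assumes A_indep: "\<And>K. indep_vars (\<lambda>_. count_space UNIV) A {..<K}"
    and X_indep: "indep_vars (\<lambda>_. borel) X UNIV"
    and AX_indep: "indep_pair (Pi\<^sub>M UNIV (\<lambda>_. count_space UNIV)) (\<lambda>\<omega> k. A k \<omega>)
                     (Pi\<^sub>M UNIV (\<lambda>_. borel)) (\<lambda>\<omega> i. X i \<omega>)"
    and A_poisson: "\<And>k b. prob {\<omega> \<in> space M. A k \<omega> = b} = exp (- \<mu> k) * \<mu> k ^ b / fact b"
    and \<mu>_bounds: "\<And>k. 0 \<le> \<mu> k \<and> \<mu> k \<le> \<mu>'"
    and X_bounds: "\<And>i \<omega>. \<omega> \<in> space M \<Longrightarrow> 0 \<le> snd (X i \<omega>) \<and> snd (X i \<omega>) \<le> fst (X i \<omega>)"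
begin

abbreviation "PA \<equiv> Pi\<^sub>M UNIV (\<lambda>_::nat. count_space (UNIV::nat set))"
abbreviation "PX \<equiv> Pi\<^sub>M UNIV (\<lambda>_::nat. borel :: (real \<times> real) measure)"

lemma A_measurable [measurable]: "A k \<in> measurable M (count_space UNIV)"
  using A_indep[of "Suc k"] by (auto simp: indep_vars_def)

lemma X_measurable [measurable]: "X i \<in> borel_measurable M"
  using X_indep by (auto simp: indep_vars_def)

lemma marks_measurable [measurable]: "(\<lambda>\<omega> i. X (l + i) \<omega>) \<in> measurable M PX"
  by (rule measurable_PiM_single') auto

lemma truncate_measurable:
  "(\<lambda>f j. if j < k then f j else 0) \<in> measurable (Pi\<^sub>M {..<k} (\<lambda>_. count_space UNIV)) PA"
  "(\<lambda>f j. if j < k then f j else 0) \<in> measurable PA PA"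
  "(\<lambda>f j. if j < k then f j else 0) \<in> measurable (Pi\<^sub>M {..<k} (\<lambda>_. borel)) PX"
  "(\<lambda>f j. if j < k then f j else 0) \<in> measurable PX PX"
proof -
  have "(\<lambda>f. if j < k then f j else 0) \<in> measurable (Pi\<^sub>M {..<k} (\<lambda>_. count_space UNIV)) (count_space (UNIV::nat set))"
    "(\<lambda>f. if j < k then f j else 0) \<in> measurable PA (count_space UNIV)"
    "(\<lambda>f. if j < k then f j else 0) \<in> measurable (Pi\<^sub>M {..<k} (\<lambda>_. borel)) (borel :: (real \<times> real) measure)"
    "(\<lambda>f. if j < k then f j else 0) \<in> measurable PX borel" for j
    by (cases "j < k"; simp)+
  then show "(\<lambda>f j. if j < k then f j else 0) \<in> measurable (Pi\<^sub>M {..<k} (\<lambda>_. count_space UNIV)) PA"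
    "(\<lambda>f j. if j < k then f j else 0) \<in> measurable PA PA"
    "(\<lambda>f j. if j < k then f j else 0) \<in> measurable (Pi\<^sub>M {..<k} (\<lambda>_. borel)) PX"
    "(\<lambda>f j. if j < k then f j else 0) \<in> measurable PX PX"
    by (auto intro!: measurable_PiM_single')
qed

text \<open>The split point \<open>l\<close> is deterministic; the random number of earlier
  customers is treated by cases later. Filling up with 0 instead of restricting yields total
  sequences that can be fed to \<open>bound_chain\<close>.\<close>

lemma past_future_indep:
  "indep_pair (PA \<Otimes>\<^sub>M PX) (\<lambda>\<omega>. (\<lambda>j. if j < k then A j \<omega> else 0, \<lambda>i. if i < l then X i \<omega> else 0))
     (count_space UNIV \<Otimes>\<^sub>M PX) (\<lambda>\<omega>. (A k \<omega>, \<lambda>i. X (l + i) \<omega>))"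
proof (rule indep_pair_pairs)
  have "indep_pair (Pi\<^sub>M {..<k} (\<lambda>_. count_space UNIV)) (\<lambda>\<omega>. restrict (\<lambda>i. A i \<omega>) {..<k})
      (Pi\<^sub>M {k} (\<lambda>_. count_space UNIV)) (\<lambda>\<omega>. restrict (\<lambda>i. A i \<omega>) {k})"
    by (rule indep_var_imp_indep_pair[OF indep_var_restrict[OF A_indep[of "Suc k"]]]) auto
  moreover note truncate_measurable(1)
  moreover have "(\<lambda>f. f k) \<in> measurable (Pi\<^sub>M {k} (\<lambda>_. count_space UNIV)) (count_space UNIV)"
    by simp
  ultimately have "indep_pair PA (\<lambda>\<omega> j. if j < k then restrict (\<lambda>i. A i \<omega>) {..<k} j else 0)
      (count_space UNIV) (\<lambda>\<omega>. restrict (\<lambda>i. A i \<omega>) {k} k)"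
    by (rule indep_pair_compose)
  then show "indep_pair PA (\<lambda>\<omega> j. if j < k then A j \<omega> else 0) (count_space UNIV) (A k)"
    by (simp cong: if_cong)
  have "indep_pair (Pi\<^sub>M {..<l} (\<lambda>_. borel)) (\<lambda>\<omega>. restrict (\<lambda>i. X i \<omega>) {..<l})
      (Pi\<^sub>M {l..} (\<lambda>_. borel)) (\<lambda>\<omega>. restrict (\<lambda>i. X i \<omega>) {l..})"
    by (rule indep_var_imp_indep_pair[OF indep_var_restrict[OF X_indep]]) auto
  moreover note truncate_measurable(3)
  moreover have "(\<lambda>f i. f (l + i)) \<in> measurable (Pi\<^sub>M {l..} (\<lambda>_. borel)) PX"
    by (rule measurable_PiM_single') auto
  ultimately have "indep_pair PX (\<lambda>\<omega> i. if i < l then restrict (\<lambda>i. X i \<omega>) {..<l} i else 0)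
      PX (\<lambda>\<omega> i. restrict (\<lambda>i. X i \<omega>) {l..} (l + i))"
    by (rule indep_pair_compose)
  then show "indep_pair PX (\<lambda>\<omega> i. if i < l then X i \<omega> else 0) PX (\<lambda>\<omega> i. X (l + i) \<omega>)"
    by (simp cong: if_cong)
  have "(\<lambda>f. (\<lambda>j. if j < k then f j else 0, f k)) \<in> measurable PA (PA \<Otimes>\<^sub>M count_space UNIV)"
    by (rule measurable_Pair[OF truncate_measurable(2)]) auto
  moreover have "(\<lambda>f i. f (l + i)) \<in> measurable PX PX"
    by (rule measurable_PiM_single') auto
  then have "(\<lambda>f. (\<lambda>i. if i < l then f i else 0, \<lambda>i. f (l + i))) \<in> measurable PX (PX \<Otimes>\<^sub>M PX)"
    by (rule measurable_Pair[OF truncate_measurable(4)])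
  ultimately show "indep_pair (PA \<Otimes>\<^sub>M count_space UNIV) (\<lambda>\<omega>. (\<lambda>j. if j < k then A j \<omega> else 0, A k \<omega>))
      (PX \<Otimes>\<^sub>M PX) (\<lambda>\<omega>. (\<lambda>i. if i < l then X i \<omega> else 0, \<lambda>i. X (l + i) \<omega>))"
    by (rule indep_pair_compose[OF AX_indep])
qed

text \<open>Conditioning on the number of arrivals in the period, which is independent of the
  marks.\<close>

lemma nn_integral_block:
  assumes h: "\<And>b. h b \<in> borel_measurable PX"
  shows "(\<integral>\<^sup>+ \<omega>. h (A k \<omega>) (\<lambda>i. X (l + i) \<omega>) \<partial>M)
    = (\<Sum>b. ennreal (exp (- \<mu> k) * \<mu> k ^ b / fact b) * (\<integral>\<^sup>+ \<omega>. h b (\<lambda>i. X (l + i) \<omega>) \<partial>M))"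
proof -
  have "(\<lambda>f i. f (l + i)) \<in> measurable PX PX" by (rule measurable_PiM_single') auto
  then have ind: "indep_pair (count_space UNIV) (A k) PX (\<lambda>\<omega> i. X (l + i) \<omega>)"
    by (rule indep_pair_compose[OF AX_indep, rotated]) simp
  have [measurable]: "(\<lambda>z. h (fst z) (snd z)) \<in> borel_measurable (count_space UNIV \<Otimes>\<^sub>M PX)"
    by (rule measurable_compose_countable[where f="\<lambda>b z. h b (snd z)"])
       (auto intro: measurable_compose[OF measurable_snd h])
  define G where "G b = (\<integral>\<^sup>+ \<omega>. h b (\<lambda>i. X (l + i) \<omega>) \<partial>M)" for b
  have "(\<integral>\<^sup>+ \<omega>. h (A k \<omega>) (\<lambda>i. X (l + i) \<omega>) \<partial>M) = (\<integral>\<^sup>+ \<omega>. G (A k \<omega>) \<partial>M)"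
    using nn_integral_indep_pair[OF ind, of "\<lambda>z. h (fst z) (snd z)"] by (simp add: G_def)
  also have "\<dots> = (\<integral>\<^sup>+ \<omega>. (\<Sum>b. G b * indicator {\<omega> \<in> space M. A k \<omega> = b} \<omega>) \<partial>M)"
  proof (intro nn_integral_cong)
    fix \<omega> assume "\<omega> \<in> space M"
    then show "G (A k \<omega>) = (\<Sum>b. G b * indicator {\<omega> \<in> space M. A k \<omega> = b} \<omega>)"
      by (subst suminf_finite[of "{A k \<omega>}"]) auto
  qed
  also have "\<dots> = (\<Sum>b. \<integral>\<^sup>+ \<omega>. G b * indicator {\<omega> \<in> space M. A k \<omega> = b} \<omega> \<partial>M)"
    by (rule nn_integral_suminf) measurable
  also have "\<dots> = (\<Sum>b. ennreal (exp (- \<mu> k) * \<mu> k ^ b / fact b) * G b)"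
    by (intro suminf_cong) (simp add: nn_integral_cmult_indicator emeasure_eq_measure A_poisson mult.commute)
  finally show ?thesis unfolding G_def .
qed

lemma arrivals_sum_measurable [measurable]: "(\<lambda>z. \<Sum>j<k. fst z j) \<in> measurable (PA \<Otimes>\<^sub>M PX) (count_space UNIV)"
  by measurable

text \<open>The number of summands and the offset are random too, so the claim is reduced to each of
  their countably many values.\<close>

lemma block_sum_measurable:
  assumes [measurable]: "g \<in> borel_measurable borel" "b \<in> measurable N (count_space UNIV)"
    "l \<in> measurable N (count_space UNIV)" "x \<in> measurable N PX"
  shows "(\<lambda>z. \<Sum>i<b z. g (x z (l z + i)) :: real) \<in> borel_measurable N"
proof -
  have "(\<lambda>z. \<Sum>i<b'. g (x z (l' + i)) :: real) \<in> borel_measurable N" for b' l' :: nat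
    by measurable
  then have "(\<lambda>z. \<Sum>i<b z. g (x z (l' + i)) :: real) \<in> borel_measurable N" for l'
    by (rule measurable_compose_countable) measurable
  then show ?thesis
    by (rule measurable_compose_countable) measurable
qed

lemma bound_step_measurable [measurable]:
  assumes [measurable]: "b \<in> measurable N (count_space UNIV)" "q \<in> borel_measurable N"
    "p \<in> borel_measurable N" "d \<in> borel_measurable N"
  shows "(\<lambda>z. bound_step \<kappa> w (b z) (q z) (p z) (d z)) \<in> borel_measurable N"
  unfolding bound_step_def by measurable

lemma bound_chain_measurable [measurable]:
  "(\<lambda>z. bound_chain \<kappa> w (fst z) (snd z) k) \<in> borel_measurable (PA \<Otimes>\<^sub>M PX)"
proof (induction k)
  case (Suc k)
  note [measurable] = Suc
  have [measurable]: "(\<lambda>z. \<Sum>i<fst z k. fst (snd z ((\<Sum>j<k. fst z j) + i))) \<in> borel_measurable (PA \<Otimes>\<^sub>M PX)"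
    "(\<lambda>z. \<Sum>i<fst z k. snd (snd z ((\<Sum>j<k. fst z j) + i))) \<in> borel_measurable (PA \<Otimes>\<^sub>M PX)"
    by (rule block_sum_measurable[where l="\<lambda>z. \<Sum>j<k. fst z j" and x=snd];
        (rule borel_measurable_continuous_onI)?, (intro continuous_intros)?, measurable)+
  show ?case by simp measurable
qed simp

lemma bound_count_measurable [measurable]:
  "(\<lambda>z. bound_count \<kappa> w (fst z) (snd z) k) \<in> measurable (PA \<Otimes>\<^sub>M PX) (count_space UNIV)"
proof (induction k)
  case (Suc k)
  note [measurable] = Suc
  show ?case by simp measurable
qed simp

lemma AX_measurable [measurable]: "(\<lambda>\<omega>. (\<lambda>j. A j \<omega>, \<lambda>i. X i \<omega>)) \<in> measurable M (PA \<Otimes>\<^sub>M PX)"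
  by (intro measurable_Pair measurable_PiM_single') auto

text \<open>A one-step inequality for every fixed state and every fixed first customer
  \<open>l\<close> lifts to the random state. On the event that \<open>l\<close> customers came
  before period \<open>k\<close>, the state is a function of the past \<open>U l\<close> and the
  next block a function of the independent future \<open>V l\<close>; summing over \<open>l\<close>
  removes the event.\<close>

lemma chain_expectation_le:
  fixes f :: "nat \<Rightarrow> real \<Rightarrow> ennreal"
  assumes f: "\<And>c. f c \<in> borel_measurable borel"
    and \<kappa>: "0 < \<kappa>" and w: "0 \<le> w"
    and step: "\<And>c d l. 0 \<le> d \<Longrightarrow>
      (\<integral>\<^sup>+ \<omega>. f (c + (if d = 0 then 0 else A k \<omega> + 1))
          (bound_step \<kappa> w (A k \<omega>) (\<Sum>i<A k \<omega>. fst (X (l + i) \<omega>)) (\<Sum>i<A k \<omega>. snd (X (l + i) \<omega>)) d) \<partial>M)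
        \<le> f c d"
  shows "(\<integral>\<^sup>+ \<omega>. f (bound_count \<kappa> w (\<lambda>j. A j \<omega>) (\<lambda>i. X i \<omega>) (Suc k))
                     (bound_chain \<kappa> w (\<lambda>j. A j \<omega>) (\<lambda>i. X i \<omega>) (Suc k)) \<partial>M)
       \<le> (\<integral>\<^sup>+ \<omega>. f (bound_count \<kappa> w (\<lambda>j. A j \<omega>) (\<lambda>i. X i \<omega>) k)
                     (bound_chain \<kappa> w (\<lambda>j. A j \<omega>) (\<lambda>i. X i \<omega>) k) \<partial>M)"
proof -
  define C D where "C = (\<lambda>k \<omega>. bound_count \<kappa> w (\<lambda>j. A j \<omega>) (\<lambda>i. X i \<omega>) k)"
    and "D = (\<lambda>k \<omega>. bound_chain \<kappa> w (\<lambda>j. A j \<omega>) (\<lambda>i. X i \<omega>) k)"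
  define L where "L \<omega> = (\<Sum>j<k. A j \<omega>)" for \<omega>
  define U where "U l \<omega> = (\<lambda>j. if j < k then A j \<omega> else 0, \<lambda>i. if i < l then X i \<omega> else 0)" for l \<omega>
  define V where "V l \<omega> = (A k \<omega>, \<lambda>i. X (l + i) \<omega>)" for l \<omega>
  define F where "F c d z = f (c + (if d = 0 then 0 else fst z + 1))
      (bound_step \<kappa> w (fst z) (\<Sum>i<fst z. fst (snd z i)) (\<Sum>i<fst z. snd (snd z i)) d)"
    for c d and z :: "nat \<times> (nat \<Rightarrow> real \<times> real)"
  \<comment> \<open>The test for \<open>l\<close> reads the past arrivals alone, so it belongs to
    the past. When it succeeds, the truncated marks determine the state.\<close>
  define G where "G l z = (if (\<Sum>j<k. fst (fst z) j) = l
      then F (bound_count \<kappa> w (fst (fst z)) (snd (fst z)) k) (bound_chain \<kappa> w (fst (fst z)) (snd (fst z)) k) (snd z)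
      else 0)" for l and z :: "((nat \<Rightarrow> nat) \<times> (nat \<Rightarrow> real \<times> real)) \<times> nat \<times> (nat \<Rightarrow> real \<times> real)"
  let ?N = "(PA \<Otimes>\<^sub>M PX) \<Otimes>\<^sub>M (count_space UNIV \<Otimes>\<^sub>M PX)"
  have [measurable]: "fst \<in> borel_measurable (borel :: (real \<times> real) measure)"
    "snd \<in> borel_measurable (borel :: (real \<times> real) measure)"
    by (intro borel_measurable_continuous_onI continuous_intros)+
  have [measurable]: "(\<lambda>z. \<Sum>i<fst (snd z). fst (snd (snd z) i)) \<in> borel_measurable ?N"
    using block_sum_measurable[of fst "\<lambda>z. fst (snd z)" ?N "\<lambda>_. 0" "\<lambda>z. snd (snd z)"] by simp
  have [measurable]: "(\<lambda>z. \<Sum>i<fst (snd z). snd (snd (snd z) i)) \<in> borel_measurable ?N"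
    using block_sum_measurable[of snd "\<lambda>z. fst (snd z)" ?N "\<lambda>_. 0" "\<lambda>z. snd (snd z)"] by simp
  have [measurable]: "(\<lambda>z. bound_chain \<kappa> w (fst (fst z)) (snd (fst z)) k) \<in> borel_measurable ?N"
    by (rule measurable_compose[OF measurable_fst bound_chain_measurable])
  have [measurable]: "(\<lambda>z. bound_count \<kappa> w (fst (fst z)) (snd (fst z)) k) \<in> measurable ?N (count_space UNIV)"
    by (rule measurable_compose[OF measurable_fst bound_count_measurable])
  have [measurable]: "(\<lambda>z. \<Sum>j<k. fst (fst z) j) \<in> measurable ?N (count_space UNIV)"
    by (rule measurable_compose[OF measurable_fst arrivals_sum_measurable])
  have G_meas [measurable]: "G l \<in> borel_measurable ?N" for l
  proof -
    have "(\<lambda>z. f (bound_count \<kappa> w (fst (fst z)) (snd (fst z)) k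
          + (if bound_chain \<kappa> w (fst (fst z)) (snd (fst z)) k = 0 then 0 else fst (snd z) + 1))
        (bound_step \<kappa> w (fst (snd z)) (\<Sum>i<fst (snd z). fst (snd (snd z) i))
           (\<Sum>i<fst (snd z). snd (snd (snd z) i)) (bound_chain \<kappa> w (fst (fst z)) (snd (fst z)) k)))
      \<in> borel_measurable ?N"
    proof (rule measurable_compose_countable[where f="\<lambda>c z. f c
        (bound_step \<kappa> w (fst (snd z)) (\<Sum>i<fst (snd z). fst (snd (snd z) i))
           (\<Sum>i<fst (snd z). snd (snd (snd z) i)) (bound_chain \<kappa> w (fst (fst z)) (snd (fst z)) k))"])
      show "(\<lambda>z. f c (bound_step \<kappa> w (fst (snd z)) (\<Sum>i<fst (snd z). fst (snd (snd z) i))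
           (\<Sum>i<fst (snd z). snd (snd (snd z) i)) (bound_chain \<kappa> w (fst (fst z)) (snd (fst z)) k)))
        \<in> borel_measurable ?N" for c
        by (rule measurable_compose[OF _ f]) measurable
    qed measurable
    then show ?thesis unfolding G_def F_def by measurable
  qed
  have ind: "indep_pair (PA \<Otimes>\<^sub>M PX) (U l) (count_space UNIV \<Otimes>\<^sub>M PX) (V l)" for l
    unfolding U_def V_def by (rule past_future_indep)
  note [measurable] = indep_pair_rv1[OF ind] indep_pair_rv2[OF ind]
  have U_eq: "bound_chain \<kappa> w (fst (U (L \<omega>) \<omega>)) (snd (U (L \<omega>) \<omega>)) k = D k \<omega>"
    "bound_count \<kappa> w (fst (U (L \<omega>) \<omega>)) (snd (U (L \<omega>) \<omega>)) k = C k \<omega>" for \<omega>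
    unfolding C_def D_def by (rule bound_chain_cong bound_count_cong; simp add: U_def L_def)+
  have L_eq: "(\<Sum>j<k. fst (U l \<omega>) j) = L \<omega>" for l \<omega>
    by (simp add: U_def L_def)
  have G_eq: "G l (U l \<omega>, z) = (if L \<omega> = l then F (C k \<omega>) (D k \<omega>) z else 0)" for l \<omega> z
    using U_eq[of \<omega>] L_eq[of l \<omega>] by (auto simp: G_def)
  have sums: "(\<Sum>l. if L \<omega> = l then h l else 0) = h (L \<omega>)" for h :: "nat \<Rightarrow> ennreal" and \<omega>
    by (subst suminf_finite[of "{L \<omega>}"]) auto
  have D_nonneg: "0 \<le> D k \<omega>" if "\<omega> \<in> space M" for \<omega>
    unfolding D_def using X_bounds[OF that] by (intro bound_chain_nonneg \<kappa> w) (meson order_trans)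
  have "(\<integral>\<^sup>+ \<omega>. f (C (Suc k) \<omega>) (D (Suc k) \<omega>) \<partial>M) = (\<integral>\<^sup>+ \<omega>. F (C k \<omega>) (D k \<omega>) (V (L \<omega>) \<omega>) \<partial>M)"
    by (simp add: F_def V_def C_def D_def L_def cong: if_cong)
  also have "\<dots> = (\<integral>\<^sup>+ \<omega>. (\<Sum>l. G l (U l \<omega>, V l \<omega>)) \<partial>M)"
    unfolding G_eq by (subst sums) (rule refl)
  also have "\<dots> = (\<Sum>l. \<integral>\<^sup>+ \<omega>. G l (U l \<omega>, V l \<omega>) \<partial>M)"
    by (rule nn_integral_suminf) measurable
  also have "\<dots> = (\<Sum>l. \<integral>\<^sup>+ \<omega>. (\<integral>\<^sup>+ \<omega>'. G l (U l \<omega>, V l \<omega>') \<partial>M) \<partial>M)"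
    by (intro suminf_cong nn_integral_indep_pair[OF ind] G_meas)
  also have "\<dots> \<le> (\<Sum>l. \<integral>\<^sup>+ \<omega>. (if L \<omega> = l then f (C k \<omega>) (D k \<omega>) else 0) \<partial>M)"
  proof (intro suminf_le nn_integral_mono summableI)
    fix l \<omega> assume \<omega>: "\<omega> \<in> space M"
    have "(\<integral>\<^sup>+ \<omega>'. F (C k \<omega>) (D k \<omega>) (V l \<omega>') \<partial>M) \<le> f (C k \<omega>) (D k \<omega>)"
      using step[OF D_nonneg[OF \<omega>], of "C k \<omega>" l] by (simp add: F_def V_def cong: if_cong)
    then show "(\<integral>\<^sup>+ \<omega>'. G l (U l \<omega>, V l \<omega>') \<partial>M) \<le> (if L \<omega> = l then f (C k \<omega>) (D k \<omega>) else 0)"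
      by (simp add: G_eq)
  qed
  also have "\<dots> = (\<integral>\<^sup>+ \<omega>. (\<Sum>l. if L \<omega> = l then f (C k \<omega>) (D k \<omega>) else 0) \<partial>M)"
  proof (rule nn_integral_suminf[symmetric])
    have [measurable]: "D k \<in> borel_measurable M"
      unfolding D_def using measurable_compose[OF AX_measurable bound_chain_measurable] by simp
    have [measurable]: "C k \<in> measurable M (count_space UNIV)"
      unfolding C_def using measurable_compose[OF AX_measurable bound_count_measurable] by simp
    have "(\<lambda>\<omega>. f (C k \<omega>) (D k \<omega>)) \<in> borel_measurable M"
      by (rule measurable_compose_countable[where f="\<lambda>c \<omega>. f c (D k \<omega>)"])
         (auto intro: measurable_compose[OF _ f])
    moreover have "L \<in> measurable M (count_space UNIV)" unfolding L_def by measurable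
    ultimately show "(\<lambda>\<omega>. if L \<omega> = l then f (C k \<omega>) (D k \<omega>) else 0) \<in> borel_measurable M" for l
      by measurable
  qed
  also have "\<dots> = (\<integral>\<^sup>+ \<omega>. f (C k \<omega>) (D k \<omega>) \<partial>M)"
    by (subst sums) (rule refl)
  finally show ?thesis unfolding C_def D_def .
qed

text \<open>Dropping the exponential costs only a constant factor, gives a bound uniform in
  \<open>k\<close>, and still leaves a series that converges against polynomial weights.\<close>

lemma arrival_prob_le: "exp (- \<mu> k) * \<mu> k ^ b / fact b \<le> \<mu>' ^ b / fact b"
proof -
  have "exp (- \<mu> k) * \<mu> k ^ b \<le> 1 * \<mu>' ^ b"
    using \<mu>_bounds[of k] by (intro mult_mono power_mono) auto
  then show ?thesis by (simp add: divide_right_mono)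
qed

lemma no_arrival_prob_ge: "exp (- \<mu>') \<le> prob {\<omega> \<in> space M. A k \<omega> = 0}"
  using A_poisson[of k 0] \<mu>_bounds[of k] by simp

text \<open>Wald's identity in the form of a bound. The exact Poisson mean is summed here, since the
  drift condition cannot afford the factor lost in \<open>arrival_prob_le\<close>.\<close>

lemma nn_integral_block_sum:
  fixes g :: "real \<times> real \<Rightarrow> ennreal"
  assumes g [measurable]: "g \<in> borel_measurable borel"
    and e: "\<And>i. (\<integral>\<^sup>+ \<omega>. g (X i \<omega>) \<partial>M) \<le> e"
  shows "(\<integral>\<^sup>+ \<omega>. (\<Sum>i<A k \<omega>. g (X (l + i) \<omega>)) \<partial>M) \<le> ennreal \<mu>' * e"
proof -
  let ?p = "\<lambda>b. exp (- \<mu> k) * \<mu> k ^ b / fact b"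
  have \<mu>0: "0 \<le> \<mu> k" using \<mu>_bounds by simp
  \<comment> \<open>Index shift for the Poisson mean: b + 1 times the weight of b + 1 is
    \<open>\<mu> k\<close> times the weight of b.\<close>
  have "(\<lambda>b. exp (- \<mu> k) * \<mu> k * (\<mu> k ^ b / fact b)) sums (exp (- \<mu> k) * \<mu> k * exp (\<mu> k))"
    by (rule sums_mult) (use exp_converges[of "\<mu> k"] in \<open>simp add: divide_inverse mult.commute\<close>)
  moreover have "exp (- \<mu> k) * \<mu> k * exp (\<mu> k) = \<mu> k"
    by (simp add: exp_minus)
  moreover have "(\<lambda>b. exp (- \<mu> k) * \<mu> k * (\<mu> k ^ b / fact b)) = (\<lambda>b. ?p (Suc b) * real (Suc b))"
    by (simp add: fun_eq_iff field_simps del: of_nat_Suc)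
  ultimately have "(\<lambda>b. ?p (Suc b) * real (Suc b)) sums \<mu> k" by (simp only:)
  then have sums: "(\<lambda>b. ?p b * real b) sums \<mu> k"
    by (subst (asm) sums_Suc_iff) simp
  have "(\<integral>\<^sup>+ \<omega>. (\<Sum>i<A k \<omega>. g (X (l + i) \<omega>)) \<partial>M)
      = (\<Sum>b. ennreal (?p b) * (\<integral>\<^sup>+ \<omega>. (\<Sum>i<b. g (X (l + i) \<omega>)) \<partial>M))"
    by (rule nn_integral_block[where h="\<lambda>b x. \<Sum>i<b. g (x i)"]) measurable
  also have "\<dots> \<le> (\<Sum>b. ennreal (?p b * real b) * e)"
  proof (intro suminf_le summableI)
    fix b
    have "(\<integral>\<^sup>+ \<omega>. (\<Sum>i<b. g (X (l + i) \<omega>)) \<partial>M) = (\<Sum>i<b. \<integral>\<^sup>+ \<omega>. g (X (l + i) \<omega>) \<partial>M)"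
      by (rule nn_integral_sum) measurable
    also have "\<dots> \<le> (\<Sum>i<b. e)" by (intro sum_mono e)
    also have "\<dots> = ennreal (real b) * e" by (simp add: ennreal_of_nat_eq_real_of_nat)
    finally have le: "(\<integral>\<^sup>+ \<omega>. (\<Sum>i<b. g (X (l + i) \<omega>)) \<partial>M) \<le> ennreal (real b) * e" .
    have "ennreal (?p b * real b) = ennreal (?p b) * ennreal (real b)"
      using \<mu>0 by (intro ennreal_mult) auto
    then show "ennreal (?p b) * (\<integral>\<^sup>+ \<omega>. (\<Sum>i<b. g (X (l + i) \<omega>)) \<partial>M) \<le> ennreal (?p b * real b) * e"
      using mult_left_mono[OF le, of "ennreal (?p b)"] by (simp only: mult.assoc) simp
  qed
  also have "\<dots> = ennreal (\<mu> k) * e"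
    using \<mu>0 sums sums_unique[OF sums] by (subst ennreal_suminf_multc) (simp add: suminf_ennreal_eq)
  also have "\<dots> \<le> ennreal \<mu>' * e"
    using \<mu>_bounds[of k] by (intro mult_right_mono ennreal_leI) auto
  finally show ?thesis .
qed

end

section \<open>Moments of the work in one block\<close>

lemma power_le_fact_exp:
  fixes x :: real
  assumes "0 \<le> x"
  shows "x ^ n \<le> fact n * exp x"
proof -
  have "x ^ n /\<^sub>R fact n \<le> (\<Sum>n. x ^ n /\<^sub>R fact n)"
    using assms summable_exp_generic[of x]
    by (intro sum_le_suminf[of _ "{n}", simplified]) auto
  then show ?thesis by (simp add: exp_def field_simps)
qed

text \<open>A power is at most a constant times an exponential, which is absorbed into the series as
  the factor \<open>exp 1\<close> on \<open>\<mu>\<close>.\<close>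

lemma summable_poisson_moment:
  fixes \<mu> c :: real
  assumes "0 \<le> \<mu>" "0 \<le> c"
  shows "summable (\<lambda>b. (c + real b) ^ n * (\<mu> ^ b / fact b))"
proof (rule summable_comparison_test')
  show "summable (\<lambda>b. fact n * exp c * ((exp 1 * \<mu>) ^ b /\<^sub>R fact b))"
    by (intro summable_mult summable_exp_generic)
  fix b
  have "(c + real b) ^ n \<le> fact n * exp (c + real b)"
    using assms by (intro power_le_fact_exp) auto
  also have "\<dots> = fact n * exp c * exp 1 ^ b"
    by (simp add: exp_add exp_of_nat_mult[of b 1, symmetric])
  finally have "(c + real b) ^ n * (\<mu> ^ b / fact b) \<le> fact n * exp c * exp 1 ^ b * (\<mu> ^ b / fact b)"
    using assms by (intro mult_right_mono) auto
  then show "norm ((c + real b) ^ n * (\<mu> ^ b / fact b)) \<le> fact n * exp c * ((exp 1 * \<mu>) ^ b /\<^sub>R fact b)"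
    using assms by (simp add: power_mult_distrib field_simps)
qed

text \<open>Each summand is at most the largest one. The exponent of the cardinality is one more
  than Jensen's inequality gives, which is harmless for Poisson numbers of summands.\<close>

lemma sum_power_le:
  fixes z :: "'i \<Rightarrow> real"
  assumes "finite I" "\<And>i. i \<in> I \<Longrightarrow> 0 \<le> z i"
  shows "(\<Sum>i\<in>I. z i) ^ Suc n \<le> real (card I) ^ Suc n * (\<Sum>i\<in>I. z i ^ Suc n)"
proof (cases "I = {}")
  case False
  define m where "m = Max (z ` I)"
  have "m \<in> z ` I" unfolding m_def using assms False by (intro Max_in) auto
  then obtain j where j: "j \<in> I" "m = z j" by auto
  have le: "z i \<le> z j" if "i \<in> I" for i
    using assms that j unfolding m_def by (metis Max_ge finite_imageI imageI)
  have "(\<Sum>i\<in>I. z i) ^ Suc n \<le> (real (card I) * z j) ^ Suc n"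
    using assms le by (intro power_mono sum_bounded_above sum_nonneg) auto
  also have "\<dots> = real (card I) ^ Suc n * z j ^ Suc n" by (rule power_mult_distrib)
  also have "\<dots> \<le> real (card I) ^ Suc n * (\<Sum>i\<in>I. z i ^ Suc n)"
    using assms j by (intro mult_left_mono member_le_sum[of j I "\<lambda>i. z i ^ Suc n"]) auto
  finally show ?thesis .
next
  case True
  then show ?thesis by simp
qed

text \<open>The product of two suprema is a double supremum, dominated along the diagonal by
  monotonicity.\<close>

lemma SUP_power_le_ennreal:
  fixes f :: "nat \<Rightarrow> ennreal"
  assumes "incseq f"
  shows "(SUP k. f k) ^ n \<le> (SUP k. f k ^ n)"
proof (induction n)
  case (Suc n)
  have "(SUP k. f k) ^ Suc n \<le> (SUP k. f k) * (SUP k. f k ^ n)"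
    using Suc by (simp add: mult_left_mono)
  also have "\<dots> = (SUP i. SUP j. f i * f j ^ n)"
    by (subst SUP_mult_right_ennreal, subst SUP_mult_left_ennreal) (rule refl)
  also have "\<dots> \<le> (SUP k. f k ^ Suc n)"
  proof (intro SUP_least)
    fix i j
    have "f i * f j ^ n \<le> f (max i j) * f (max i j) ^ n"
      using assms by (intro mult_mono power_mono_ennreal) (auto simp: incseq_def)
    also have "\<dots> \<le> (SUP k. f k ^ Suc n)"
      by (rule SUP_upper2[of "max i j"]) auto
    finally show "f i * f j ^ n \<le> (SUP k. f k ^ Suc n)" .
  qed
  finally show ?case .
qed simp

lemma lyapunov_measurable: "lyapunov n z \<epsilon> r J \<kappa> c \<in> borel_measurable borel"
proof -
  have [measurable]: "(\<lambda>d::real. \<lceil>d / \<kappa>\<rceil>) \<in> measurable borel (count_space UNIV)"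
    by measurable
  have "(\<lambda>d::real. 2 - r ^ min J (nat \<lceil>d / \<kappa>\<rceil>)) \<in> borel_measurable borel"
    by (rule measurable_compose[where f="\<lambda>d::real. \<lceil>d / \<kappa>\<rceil>" and N="count_space UNIV"
          and g="\<lambda>i. 2 - r ^ min J (nat i)"]) auto
  then show ?thesis unfolding lyapunov_def level_weight_def by measurable
qed

context marked_blocks
begin

lemma fst_snd_measurable [measurable]:
  "fst \<in> borel_measurable (borel :: (real \<times> real) measure)"
  "snd \<in> borel_measurable (borel :: (real \<times> real) measure)"
  by (intro borel_measurable_continuous_onI continuous_intros)+

lemma block_measurable [measurable]:
  "(\<lambda>\<omega>. \<Sum>i<A k \<omega>. fst (X (l + i) \<omega>)) \<in> borel_measurable M"
  "(\<lambda>\<omega>. \<Sum>i<A k \<omega>. snd (X (l + i) \<omega>)) \<in> borel_measurable M"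
  using block_sum_measurable[of fst "A k" M "\<lambda>_. l" "\<lambda>\<omega> i. X i \<omega>"]
    block_sum_measurable[of snd "A k" M "\<lambda>_. l" "\<lambda>\<omega> i. X i \<omega>"] marks_measurable[of 0]
  by auto

lemma \<mu>'_nonneg: "0 \<le> \<mu>'"
  using \<mu>_bounds[of 0] by linarith

lemma nn_integral_block_le:
  assumes h: "\<And>b. h b \<in> borel_measurable PX"
    and c: "\<And>b. 0 \<le> c b" "summable (\<lambda>b. c b * (\<mu>' ^ b / fact b))"
    and le: "\<And>b. (\<integral>\<^sup>+ \<omega>. h b (\<lambda>i. X (l + i) \<omega>) \<partial>M) \<le> ennreal (c b)"
  shows "(\<integral>\<^sup>+ \<omega>. h (A k \<omega>) (\<lambda>i. X (l + i) \<omega>) \<partial>M) \<le> ennreal (\<Sum>b. c b * (\<mu>' ^ b / fact b))"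
proof -
  have "(\<integral>\<^sup>+ \<omega>. h (A k \<omega>) (\<lambda>i. X (l + i) \<omega>) \<partial>M)
      = (\<Sum>b. ennreal (exp (- \<mu> k) * \<mu> k ^ b / fact b) * (\<integral>\<^sup>+ \<omega>. h b (\<lambda>i. X (l + i) \<omega>) \<partial>M))"
    by (rule nn_integral_block[OF h])
  also have "\<dots> \<le> (\<Sum>b. ennreal (c b * (\<mu>' ^ b / fact b)))"
  proof (intro suminf_le summableI)
    fix b
    have "ennreal (exp (- \<mu> k) * \<mu> k ^ b / fact b) * (\<integral>\<^sup>+ \<omega>. h b (\<lambda>i. X (l + i) \<omega>) \<partial>M)
        \<le> ennreal (\<mu>' ^ b / fact b) * ennreal (c b)"
      by (intro mult_mono le ennreal_leI arrival_prob_le) auto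
    also have "\<dots> = ennreal (c b * (\<mu>' ^ b / fact b))"
      using c(1) \<mu>'_nonneg by (subst mult.commute, intro ennreal_mult[symmetric]) auto
    finally show "ennreal (exp (- \<mu> k) * \<mu> k ^ b / fact b) * (\<integral>\<^sup>+ \<omega>. h b (\<lambda>i. X (l + i) \<omega>) \<partial>M)
        \<le> ennreal (c b * (\<mu>' ^ b / fact b))" .
  qed
  also have "\<dots> = ennreal (\<Sum>b. c b * (\<mu>' ^ b / fact b))"
    using c \<mu>'_nonneg by (intro suminf_ennreal2) auto
  finally show ?thesis .
qed

lemma arrivals_square_bounded:
  obtains K where "0 \<le> K" "\<And>k. (\<integral>\<^sup>+ \<omega>. ennreal ((real (A k \<omega>))\<^sup>2) \<partial>M) \<le> ennreal K"
proof
  let ?K = "\<Sum>b. (0 + real b) ^ 2 * (\<mu>' ^ b / fact b)"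
  show "0 \<le> ?K"
    using \<mu>'_nonneg by (intro suminf_nonneg summable_poisson_moment) auto
  show "(\<integral>\<^sup>+ \<omega>. ennreal ((real (A k \<omega>))\<^sup>2) \<partial>M) \<le> ennreal ?K" for k
    using \<mu>'_nonneg
    by (intro nn_integral_block_le[where h="\<lambda>b x. ennreal ((real b)\<^sup>2)" and l=0] summable_poisson_moment)
       (auto simp: emeasure_space_1)
qed

lemma block_moment_bounded:
  assumes a: "1 \<le> a" and e: "0 \<le> e" "\<And>i. (\<integral>\<^sup>+ \<omega>. ennreal (fst (X i \<omega>) ^ Suc n) \<partial>M) \<le> ennreal e"
  obtains K where "0 \<le> K"
    "\<And>k l. (\<integral>\<^sup>+ \<omega>. ennreal ((a + real (A k \<omega>) + 2 * (\<Sum>i<A k \<omega>. fst (X (l + i) \<omega>))) ^ Suc n) \<partial>M) \<le> ennreal K"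
proof -
  \<comment> \<open>Bound for \<open>b\<close> arrivals: \<open>sum_power_le\<close> with b + 1
    summands, followed by \<open>b + 1 \<le> a + b\<close> (from \<open>1 \<le> a\<close>) and
    \<open>b \<le> a + b\<close>, so that only powers of \<open>a + b\<close> remain.\<close>
  define c where "c b = (a + real b) ^ (2 * Suc n) + 2 ^ Suc n * e * (a + real b) ^ Suc (Suc n)" for b :: nat
  have c0: "0 \<le> c b" for b using a e by (simp add: c_def)
  have sm: "summable (\<lambda>b. c b * (\<mu>' ^ b / fact b))"
  proof -
    have "summable (\<lambda>b. (a + real b) ^ (2 * Suc n) * (\<mu>' ^ b / fact b)
        + 2 ^ Suc n * e * ((a + real b) ^ Suc (Suc n) * (\<mu>' ^ b / fact b)))"
      using a \<mu>'_nonneg by (intro summable_add summable_mult summable_poisson_moment) auto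
    then show ?thesis by (simp only: c_def distrib_right mult.assoc)
  qed
  have le: "(\<integral>\<^sup>+ \<omega>. ennreal ((a + real b + 2 * (\<Sum>i<b. fst (X (l + i) \<omega>))) ^ Suc n) \<partial>M) \<le> ennreal (c b)" for b l
  proof -
    let ?u = "a + real b"
    have "(\<integral>\<^sup>+ \<omega>. ennreal ((?u + 2 * (\<Sum>i<b. fst (X (l + i) \<omega>))) ^ Suc n) \<partial>M)
        \<le> (\<integral>\<^sup>+ \<omega>. ennreal (?u ^ Suc n) * (ennreal (?u ^ Suc n)
             + ennreal (2 ^ Suc n) * (\<Sum>i<b. ennreal (fst (X (l + i) \<omega>) ^ Suc n))) \<partial>M)"
    proof (rule nn_integral_mono)
      fix \<omega> assume \<omega>: "\<omega> \<in> space M"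
      define q where "q i = fst (X (l + i) \<omega>)" for i
      have q: "0 \<le> q i" for i using X_bounds[OF \<omega>, of "l + i"] by (simp add: q_def)
      \<comment> \<open>The deterministic part is treated as one more summand, with index
        \<open>b\<close>.\<close>
      define z where "z i = (if i = b then ?u else 2 * q i)" for i
      have sp: "(\<Sum>i\<le>b. g (z i)) = g ?u + (\<Sum>i<b. g (2 * q i))" for g :: "real \<Rightarrow> real"
        by (simp add: z_def lessThan_Suc_atMost[symmetric] add.commute)
      have "(?u + 2 * (\<Sum>i<b. q i)) ^ Suc n = (\<Sum>i\<le>b. z i) ^ Suc n"
        using sp[of "\<lambda>x. x"] by (simp add: sum_distrib_left)
      also have "\<dots> \<le> real (card {..b}) ^ Suc n * (\<Sum>i\<le>b. z i ^ Suc n)"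
        using a q by (intro sum_power_le) (auto simp: z_def)
      also have "\<dots> = real (b + 1) ^ Suc n * (?u ^ Suc n + (\<Sum>i<b. (2 * q i) ^ Suc n))"
        using sp[of "\<lambda>x. x ^ Suc n"] by simp
      also have "\<dots> \<le> ?u ^ Suc n * (?u ^ Suc n + (\<Sum>i<b. (2 * q i) ^ Suc n))"
        using a q by (intro mult_right_mono power_mono add_nonneg_nonneg sum_nonneg) auto
      also have "(\<Sum>i<b. (2 * q i) ^ Suc n) = 2 ^ Suc n * (\<Sum>i<b. q i ^ Suc n)"
        by (simp only: power_mult_distrib sum_distrib_left)
      finally have "ennreal ((?u + 2 * (\<Sum>i<b. q i)) ^ Suc n)
          \<le> ennreal (?u ^ Suc n * (?u ^ Suc n + 2 ^ Suc n * (\<Sum>i<b. q i ^ Suc n)))"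
        by (rule ennreal_leI)
      also have "\<dots> = ennreal (?u ^ Suc n) * (ennreal (?u ^ Suc n)
          + ennreal (2 ^ Suc n) * (\<Sum>i<b. ennreal (q i ^ Suc n)))"
        using a q by (simp add: ennreal_mult' ennreal_plus sum_nonneg sum_ennreal del: power_Suc ennreal_numeral)
      finally show "ennreal ((?u + 2 * (\<Sum>i<b. fst (X (l + i) \<omega>))) ^ Suc n)
          \<le> ennreal (?u ^ Suc n) * (ennreal (?u ^ Suc n)
             + ennreal (2 ^ Suc n) * (\<Sum>i<b. ennreal (fst (X (l + i) \<omega>) ^ Suc n)))"
        by (simp only: q_def)
    qed
    also have "\<dots> = ennreal (?u ^ Suc n) * (ennreal (?u ^ Suc n)
             + ennreal (2 ^ Suc n) * (\<Sum>i<b. \<integral>\<^sup>+ \<omega>. ennreal (fst (X (l + i) \<omega>) ^ Suc n) \<partial>M))"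
      by (simp add: nn_integral_cmult nn_integral_add nn_integral_sum emeasure_space_1
          del: power_Suc ennreal_numeral)
    also have "\<dots> \<le> ennreal (?u ^ Suc n) * (ennreal (?u ^ Suc n) + ennreal (2 ^ Suc n) * (\<Sum>i<b. ennreal e))"
      by (intro mult_left_mono add_left_mono sum_mono e) auto
    also have "\<dots> = ennreal (?u ^ Suc n * (?u ^ Suc n + 2 ^ Suc n * (real b * e)))"
    proof -
      have "(\<Sum>i<b. ennreal e) = ennreal (real b * e)"
        using e by (simp add: ennreal_mult' ennreal_of_nat_eq_real_of_nat)
      then show ?thesis
        using a e by (simp add: ennreal_mult' ennreal_plus del: power_Suc ennreal_numeral sum_constant)
    qed
    also have "\<dots> \<le> ennreal (c b)"
    proof (rule ennreal_leI)
      have "?u ^ Suc n * (2 ^ Suc n * (real b * e)) \<le> ?u ^ Suc n * (2 ^ Suc n * (?u * e))"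
        using a e by (intro mult_left_mono mult_right_mono) auto
      then show "?u ^ Suc n * (?u ^ Suc n + 2 ^ Suc n * (real b * e)) \<le> c b"
        by (simp add: c_def power_mult power2_eq_square algebra_simps power_mult_distrib)
    qed
    finally show ?thesis .
  qed
  show ?thesis
  proof (rule that)
    show "0 \<le> (\<Sum>b. c b * (\<mu>' ^ b / fact b))"
      using sm c0 \<mu>'_nonneg by (intro suminf_nonneg) auto
    show "(\<integral>\<^sup>+ \<omega>. ennreal ((a + real (A k \<omega>) + 2 * (\<Sum>i<A k \<omega>. fst (X (l + i) \<omega>))) ^ Suc n) \<partial>M)
        \<le> ennreal (\<Sum>b. c b * (\<mu>' ^ b / fact b))" for k l
      by (rule nn_integral_block_le[where h="\<lambda>b x. ennreal ((a + real b + 2 * (\<Sum>i<b. fst (x i))) ^ Suc n)"])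
         (use c0 sm le in \<open>auto intro!: measurable_compose[OF _ measurable_ennreal]\<close>)
  qed
qed

end

section \<open>The expected Lyapunov function does not increase\<close>

lemma lyapunov_nonneg:
  assumes "0 \<le> z" "0 \<le> \<epsilon>" "0 < r" "r \<le> 1" "0 \<le> d"
  shows "0 \<le> lyapunov n z \<epsilon> r J \<kappa> c d"
  unfolding lyapunov_def
  using assms order_trans[OF zero_le_one level_weight_bounds(1)[OF assms(3,4)]]
  by (intro mult_nonneg_nonneg zero_le_power) auto

context marked_blocks
begin

text \<open>\<open>r\<close> is chosen so that a period is empty with probability at least
  \<open>2 * r\<close>. The conditions on \<open>z\<close> belong to the two regimes: the first lets
  \<open>Z * r ^ J\<close> pay for the crude error at low levels, the second lets the drift gain pay
  for the second-order error at high levels.\<close>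

lemma lyapunov_expected_step:
  fixes n J c k l :: nat
  defines "r \<equiv> exp (- \<mu>') / 2"
  assumes par: "0 < \<kappa>" "0 \<le> w" "0 < \<epsilon>" "\<epsilon> \<le> 1" "1 \<le> z" "1 \<le> J" "w + \<kappa> \<le> \<kappa> * real J"
    and K: "0 \<le> K" "(\<integral>\<^sup>+ \<omega>. ennreal ((2 + \<kappa> + real (A k \<omega>) + 2 * (\<Sum>i<A k \<omega>. fst (X (l + i) \<omega>))) ^ Suc n) \<partial>M) \<le> ennreal K"
    and \<delta>: "\<delta> \<le> \<kappa>" "(\<integral>\<^sup>+ \<omega>. ennreal ((\<Sum>i<A k \<omega>. snd (X (l + i) \<omega>))
          + max 0 ((\<Sum>i<A k \<omega>. fst (X (l + i) \<omega>)) - (\<kappa> * real J - w - \<kappa>))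
          + \<epsilon> * real (A k \<omega> + 1)) \<partial>M) \<le> ennreal (\<kappa> - \<delta>)"
    and z: "2 * K \<le> z * r ^ J" "K \<le> z * (real (Suc n) * \<delta>)"
    and d: "0 \<le> d"
  shows "(\<integral>\<^sup>+ \<omega>. ennreal (lyapunov n z \<epsilon> r J \<kappa> (c + (if d = 0 then 0 else A k \<omega> + 1))
      (bound_step \<kappa> w (A k \<omega>) (\<Sum>i<A k \<omega>. fst (X (l + i) \<omega>)) (\<Sum>i<A k \<omega>. snd (X (l + i) \<omega>)) d)) \<partial>M)
    \<le> ennreal (lyapunov n z \<epsilon> r J \<kappa> c d)"
proof (cases "d = 0")
  case True
  then show ?thesis by (simp add: bound_step_def emeasure_space_1)
next
  case False
  then have d: "0 < d" using d by simp
  define Z where "Z = z + \<epsilon> * real c + d"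
  define Q where "Q \<omega> = (\<Sum>i<A k \<omega>. fst (X (l + i) \<omega>))" for \<omega>
  define P where "P \<omega> = (\<Sum>i<A k \<omega>. snd (X (l + i) \<omega>))" for \<omega>
  define T where "T \<omega> = (2 + \<kappa> + real (A k \<omega>) + 2 * Q \<omega>) ^ Suc n" for \<omega>
  define v where "v \<omega> = lyapunov n z \<epsilon> r J \<kappa> (c + A k \<omega> + 1) (bound_step \<kappa> w (A k \<omega>) (Q \<omega>) (P \<omega>) d)" for \<omega>
  have [measurable]: "Q \<in> borel_measurable M" "P \<in> borel_measurable M"
    unfolding Q_def P_def by measurable
  have [measurable]: "T \<in> borel_measurable M"
    unfolding T_def by measurable
  have [measurable]: "v \<in> borel_measurable M"
    unfolding v_def
    by (rule measurable_compose_countable[where f="\<lambda>c' \<omega>. lyapunov n z \<epsilon> r J \<kappa> c'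
          (bound_step \<kappa> w (A k \<omega>) (Q \<omega>) (P \<omega>) d)"])
       (auto intro!: measurable_compose[OF _ lyapunov_measurable])
  have "exp (- \<mu>') \<le> 1" using \<mu>'_nonneg by simp
  then have r: "0 < r" "r \<le> 1" "2 * r \<le> 1" unfolding r_def by (simp, linarith, simp)
  have PQ: "0 \<le> P \<omega>" "P \<omega> \<le> Q \<omega>" if "\<omega> \<in> space M" for \<omega>
    unfolding P_def Q_def using X_bounds[OF that] by (auto intro!: sum_nonneg sum_mono)
  have T0: "0 \<le> T \<omega>" if "\<omega> \<in> space M" for \<omega>
    using PQ[OF that] par by (simp add: T_def)
  have Zz: "z \<le> Z" unfolding Z_def using par d by simp
  then have Z1: "1 \<le> Z" "0 < Z" "0 \<le> Z" using par by linarith+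
  have rJ: "0 \<le> r ^ J" "r ^ J \<le> 1" using r by (auto intro: power_le_one)
  have v0: "0 \<le> v \<omega>" if "\<omega> \<in> space M" for \<omega>
  proof -
    have "0 \<le> bound_step \<kappa> w (A k \<omega>) (Q \<omega>) (P \<omega>) d"
      unfolding bound_step_def using d par PQ[OF that] by auto
    then show ?thesis
      unfolding v_def using par r by (intro lyapunov_nonneg) auto
  qed
  have goal_eq: "(\<integral>\<^sup>+ \<omega>. ennreal (lyapunov n z \<epsilon> r J \<kappa> (c + (if d = 0 then 0 else A k \<omega> + 1))
      (bound_step \<kappa> w (A k \<omega>) (\<Sum>i<A k \<omega>. fst (X (l + i) \<omega>)) (\<Sum>i<A k \<omega>. snd (X (l + i) \<omega>)) d)) \<partial>M)
      = (\<integral>\<^sup>+ \<omega>. ennreal (v \<omega>) \<partial>M)"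
    using False by (simp add: v_def Q_def P_def)
  have intT: "(\<integral>\<^sup>+ \<omega>. ennreal (T \<omega>) \<partial>M) \<le> ennreal K"
    using K(2) by (simp add: T_def Q_def)
  show ?thesis
    unfolding goal_eq
  proof (cases "d \<le> \<kappa> * real J")
    case low: True
    define j where "j = nat \<lceil>d / \<kappa>\<rceil>"
    define s where "s = Z ^ Suc n * (r ^ (j - 1) - r ^ J)"
    have j: "0 < j" "j \<le> J" and lw: "level_weight r J \<kappa> d = 2 - r ^ j"
      using level_weight_low(1,2)[OF par(1) d low] level_weight_low(3)[OF par(1) d low, of r]
      by (auto simp: j_def)
    have rj: "r ^ J \<le> r ^ j" "r ^ J \<le> r ^ (j - 1)" "r * r ^ (j - 1) = r ^ j"
      using j r power_decreasing[of j J r] power_decreasing[of "j - 1" J r]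
      by (auto simp: power_Suc[symmetric] simp del: power_Suc)
    have s0: "0 \<le> s" using rj Z1 by (simp add: s_def)
    have pw: "v \<omega> + s * indicator {\<omega> \<in> space M. A k \<omega> = 0} \<omega> \<le> Z ^ Suc n * (2 - r ^ J) + 2 * Z ^ n * T \<omega>"
      if "\<omega> \<in> space M" for \<omega>
    proof -
      have ind: "indicator {\<omega> \<in> space M. A k \<omega> = 0} \<omega> = (if A k \<omega> = 0 then 1 else 0 :: real)"
        using that by (simp add: indicator_def)
      show ?thesis
        unfolding ind v_def s_def j_def Z_def T_def
        by (rule lyapunov_step_low[OF par(1-5) r(1,2) d low PQ[OF that]])
    qed
    \<comment> \<open>The bonus is added on the left and cancelled at the end, which avoids
      subtraction in \<open>ennreal\<close>.\<close>
    have "(\<integral>\<^sup>+ \<omega>. ennreal (v \<omega>) \<partial>M) + ennreal s * emeasure M {\<omega> \<in> space M. A k \<omega> = 0}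
        = (\<integral>\<^sup>+ \<omega>. (ennreal (v \<omega>) + ennreal s * indicator {\<omega> \<in> space M. A k \<omega> = 0} \<omega>) \<partial>M)"
      by (simp add: nn_integral_add nn_integral_cmult_indicator)
    also have "\<dots> \<le> (\<integral>\<^sup>+ \<omega>. (ennreal (Z ^ Suc n * (2 - r ^ J)) + ennreal (2 * Z ^ n) * ennreal (T \<omega>)) \<partial>M)"
    proof (rule nn_integral_mono)
      fix \<omega> assume \<omega>: "\<omega> \<in> space M"
      have "ennreal (v \<omega>) + ennreal s * indicator {\<omega> \<in> space M. A k \<omega> = 0} \<omega>
          = ennreal (v \<omega> + s * indicator {\<omega> \<in> space M. A k \<omega> = 0} \<omega>)"
        using v0[OF \<omega>] s0 by (simp add: indicator_def ennreal_plus)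
      also have "\<dots> \<le> ennreal (Z ^ Suc n * (2 - r ^ J) + 2 * Z ^ n * T \<omega>)"
        by (rule ennreal_leI[OF pw[OF \<omega>]])
      also have "\<dots> = ennreal (Z ^ Suc n * (2 - r ^ J)) + ennreal (2 * Z ^ n) * ennreal (T \<omega>)"
        using Z1 rJ T0[OF \<omega>] by (simp add: ennreal_plus ennreal_mult'' del: power_Suc)
      finally show "ennreal (v \<omega>) + ennreal s * indicator {\<omega> \<in> space M. A k \<omega> = 0} \<omega>
          \<le> ennreal (Z ^ Suc n * (2 - r ^ J)) + ennreal (2 * Z ^ n) * ennreal (T \<omega>)" .
    qed
    also have "\<dots> = ennreal (Z ^ Suc n * (2 - r ^ J)) + ennreal (2 * Z ^ n) * (\<integral>\<^sup>+ \<omega>. ennreal (T \<omega>) \<partial>M)"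
      by (simp add: nn_integral_add nn_integral_cmult emeasure_space_1 del: power_Suc)
    also have "\<dots> \<le> ennreal (Z ^ Suc n * (2 - r ^ J)) + ennreal (2 * Z ^ n) * ennreal K"
      by (intro add_left_mono mult_left_mono intT) auto
    also have "\<dots> = ennreal (Z ^ Suc n * (2 - r ^ J) + 2 * Z ^ n * K)"
      using Z1 rJ K by (simp add: ennreal_plus ennreal_mult'' del: power_Suc)
    also have "\<dots> \<le> ennreal (Z ^ Suc n * (2 - r ^ j) + s * (2 * r))"
    proof (rule ennreal_leI)
      have "2 * K \<le> Z * r ^ J" using z(1) mult_right_mono[OF Zz rJ(1)] by linarith
      then have "Z ^ n * (2 * K) \<le> Z ^ n * (Z * r ^ J)" using Z1 by (intro mult_left_mono) auto
      then have 1: "2 * Z ^ n * K \<le> Z ^ Suc n * r ^ J" by (simp add: mult_ac)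
      have "r ^ J * (2 * r) \<le> r ^ J * 1" using r rJ by (intro mult_left_mono) auto
      \<comment> \<open>The expected bonus \<open>2 * r * (r ^ (j - 1) - r ^ J)\<close> is at least
        \<open>r ^ j\<close>, since \<open>r * r ^ (j - 1) = r ^ j\<close>,
        \<open>2 * r \<le> 1\<close> and \<open>r ^ J \<le> r ^ j\<close>. This lowers the bound 2
        to the present weight \<open>2 - r ^ j\<close>.\<close>
      then have "2 - r ^ J + r ^ J \<le> 2 - r ^ j + (r ^ (j - 1) - r ^ J) * (2 * r)"
        using rj by (simp add: algebra_simps)
      then have "Z ^ Suc n * (2 - r ^ J + r ^ J) \<le> Z ^ Suc n * (2 - r ^ j + (r ^ (j - 1) - r ^ J) * (2 * r))"
        using Z1 by (intro mult_left_mono) auto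
      also have "\<dots> = Z ^ Suc n * (2 - r ^ j) + s * (2 * r)"
        unfolding s_def by (simp only: distrib_left mult.assoc)
      finally show "Z ^ Suc n * (2 - r ^ J) + 2 * Z ^ n * K \<le> Z ^ Suc n * (2 - r ^ j) + s * (2 * r)"
        using 1 by (simp only: distrib_left)
    qed
    also have "\<dots> = ennreal (s * (2 * r)) + ennreal (Z ^ Suc n * (2 - r ^ j))"
      using s0 r Z1 power_le_one[of r j] by (subst add.commute, intro ennreal_plus) auto
    finally have fin: "(\<integral>\<^sup>+ \<omega>. ennreal (v \<omega>) \<partial>M) + ennreal s * emeasure M {\<omega> \<in> space M. A k \<omega> = 0}
        \<le> ennreal (s * (2 * r)) + ennreal (Z ^ Suc n * (2 - r ^ j))" .
    have "ennreal (s * (2 * r)) \<le> ennreal s * emeasure M {\<omega> \<in> space M. A k \<omega> = 0}"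
      using s0 no_arrival_prob_ge[of k]
      by (simp add: emeasure_eq_measure r_def ennreal_mult' mult_left_mono ennreal_leI)
    then have "ennreal (s * (2 * r)) + (\<integral>\<^sup>+ \<omega>. ennreal (v \<omega>) \<partial>M)
        \<le> ennreal (s * (2 * r)) + ennreal (Z ^ Suc n * (2 - r ^ j))"
      using fin by (subst add.commute) (meson add_left_mono order_trans)
    then have "(\<integral>\<^sup>+ \<omega>. ennreal (v \<omega>) \<partial>M) \<le> ennreal (Z ^ Suc n * (2 - r ^ j))"
      by (simp add: ennreal_add_left_cancel_le)
    then show "(\<integral>\<^sup>+ \<omega>. ennreal (v \<omega>) \<partial>M) \<le> ennreal (lyapunov n z \<epsilon> r J \<kappa> c d)"
      unfolding lyapunov_def lw Z_def .
  next
    case high: False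
    define x where "x = \<kappa> * real J - w - \<kappa>"
    define R where "R \<omega> = P \<omega> + max 0 (Q \<omega> - x) + \<epsilon> * real (A k \<omega> + 1)" for \<omega>
    define s where "s = (2 - r ^ J) * real (Suc n) * Z ^ n"
    have [measurable]: "R \<in> borel_measurable M" unfolding R_def by measurable
    have x0: "0 \<le> x" using par by (simp add: x_def)
    have s0: "0 \<le> s" using rJ Z1 by (simp add: s_def)
    have lw: "level_weight r J \<kappa> d = 2 - r ^ J"
      using level_weight_high[OF par(1)] high by simp
    have R0: "0 \<le> R \<omega>" if "\<omega> \<in> space M" for \<omega>
      using PQ[OF that] par by (simp add: R_def)
    define t where "t = (2 - r ^ J) * (Z ^ n / Z)"
    have t0: "0 \<le> t" using rJ Z1 by (simp add: t_def)
    have pw: "v \<omega> + s * \<kappa> \<le> (2 - r ^ J) * Z ^ Suc n + s * R \<omega> + t * T \<omega>" if "\<omega> \<in> space M" for \<omega>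
    proof -
      have "v \<omega> + (2 - r ^ J) * real (Suc n) * Z ^ n * \<kappa>
          \<le> (2 - r ^ J) * (Z ^ Suc n + real (Suc n) * Z ^ n * R \<omega> + Z ^ n / Z * T \<omega>)"
        unfolding v_def Z_def T_def R_def
        by (rule lyapunov_step_high[OF par(1-5) r(1,2) par(6)])
           (use par high PQ[OF that] x0 in \<open>auto simp: x_def\<close>)
      then show ?thesis by (simp only: s_def t_def distrib_left mult.assoc)
    qed
    have "(\<integral>\<^sup>+ \<omega>. ennreal (v \<omega>) \<partial>M) + ennreal (s * \<kappa>)
        = (\<integral>\<^sup>+ \<omega>. (ennreal (v \<omega>) + ennreal (s * \<kappa>)) \<partial>M)"
      by (simp add: nn_integral_add emeasure_space_1)
    also have "\<dots> \<le> (\<integral>\<^sup>+ \<omega>. (ennreal ((2 - r ^ J) * Z ^ Suc n) + ennreal s * ennreal (R \<omega>) + ennreal t * ennreal (T \<omega>)) \<partial>M)"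
    proof (rule nn_integral_mono)
      fix \<omega> assume \<omega>: "\<omega> \<in> space M"
      have "ennreal (v \<omega>) + ennreal (s * \<kappa>) = ennreal (v \<omega> + s * \<kappa>)"
        using v0[OF \<omega>] s0 par by (simp add: ennreal_plus)
      also have "\<dots> \<le> ennreal ((2 - r ^ J) * Z ^ Suc n + s * R \<omega> + t * T \<omega>)"
        by (rule ennreal_leI[OF pw[OF \<omega>]])
      also have "\<dots> = ennreal ((2 - r ^ J) * Z ^ Suc n) + ennreal s * ennreal (R \<omega>) + ennreal t * ennreal (T \<omega>)"
        using Z1 rJ T0[OF \<omega>] R0[OF \<omega>] s0 t0 by (simp add: ennreal_plus ennreal_mult'' del: power_Suc)
      finally show "ennreal (v \<omega>) + ennreal (s * \<kappa>)
          \<le> ennreal ((2 - r ^ J) * Z ^ Suc n) + ennreal s * ennreal (R \<omega>) + ennreal t * ennreal (T \<omega>)" .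
    qed
    also have "\<dots> = ennreal ((2 - r ^ J) * Z ^ Suc n) + ennreal s * (\<integral>\<^sup>+ \<omega>. ennreal (R \<omega>) \<partial>M)
        + ennreal t * (\<integral>\<^sup>+ \<omega>. ennreal (T \<omega>) \<partial>M)"
      by (simp add: nn_integral_add nn_integral_cmult emeasure_space_1 del: power_Suc)
    also have "\<dots> \<le> ennreal ((2 - r ^ J) * Z ^ Suc n) + ennreal s * ennreal (\<kappa> - \<delta>) + ennreal t * ennreal K"
      using \<delta>(2) intT by (intro add_mono mult_left_mono) (auto simp: R_def P_def Q_def x_def)
    also have "\<dots> = ennreal ((2 - r ^ J) * Z ^ Suc n + s * (\<kappa> - \<delta>) + t * K)"
      using Z1 rJ K s0 t0 \<delta>(1) by (simp add: ennreal_plus ennreal_mult'' del: power_Suc)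
    also have "\<dots> \<le> ennreal ((2 - r ^ J) * Z ^ Suc n + s * \<kappa>)"
    proof (rule ennreal_leI)
      \<comment> \<open>The sign of \<open>\<delta>\<close> follows from
        \<open>0 \<le> K \<le> z * (real (Suc n) * \<delta>)\<close>.\<close>
      have "0 \<le> real (Suc n) * \<delta>"
      proof (rule ccontr)
        assume "\<not> 0 \<le> real (Suc n) * \<delta>"
        then have "z * (real (Suc n) * \<delta>) < 0" using par by (simp add: mult_pos_neg)
        then show False using z(2) K(1) by linarith
      qed
      then have "K \<le> Z * (real (Suc n) * \<delta>)"
        using z(2) mult_right_mono[OF Zz, of "real (Suc n) * \<delta>"] by linarith
      then have "K / Z \<le> real (Suc n) * \<delta>" using Z1 by (simp add: field_simps)
      then have "(2 - r ^ J) * Z ^ n * (K / Z) \<le> (2 - r ^ J) * Z ^ n * (real (Suc n) * \<delta>)"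
        using Z1 rJ by (intro mult_left_mono) auto
      then have "t * K \<le> s * \<delta>" by (simp add: t_def s_def mult_ac)
      then show "(2 - r ^ J) * Z ^ Suc n + s * (\<kappa> - \<delta>) + t * K \<le> (2 - r ^ J) * Z ^ Suc n + s * \<kappa>"
        by (simp add: right_diff_distrib)
    qed
    also have "\<dots> = ennreal (Z ^ Suc n * (2 - r ^ J)) + ennreal (s * \<kappa>)"
      using Z1 rJ s0 par by (subst ennreal_plus) (auto simp: mult.commute)
    finally have "ennreal (s * \<kappa>) + (\<integral>\<^sup>+ \<omega>. ennreal (v \<omega>) \<partial>M)
        \<le> ennreal (s * \<kappa>) + ennreal (Z ^ Suc n * (2 - r ^ J))"
      by (simp only: add.commute)
    then have "(\<integral>\<^sup>+ \<omega>. ennreal (v \<omega>) \<partial>M) \<le> ennreal (Z ^ Suc n * (2 - r ^ J))"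
      by (simp add: ennreal_add_left_cancel_le del: power_Suc)
    then show "(\<integral>\<^sup>+ \<omega>. ennreal (v \<omega>) \<partial>M) \<le> ennreal (lyapunov n z \<epsilon> r J \<kappa> c d)"
      unfolding lyapunov_def lw Z_def .
  qed
qed

section \<open>Uniform drift bound and moments of the count\<close>

lemma block_ennreal_measurable:
  fixes g :: "real \<times> real \<Rightarrow> ennreal"
  assumes [measurable]: "g \<in> borel_measurable borel"
  shows "(\<lambda>\<omega>. \<Sum>i<A k \<omega>. g (X (l + i) \<omega>)) \<in> borel_measurable M"
  by (rule measurable_compose_countable[where f="\<lambda>b \<omega>. \<Sum>i<b. g (X (l + i) \<omega>)"]) measurable

text \<open>The budget beyond \<open>\<mu>' * p\<close> is four shares of \<open>\<delta>\<close>: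
  services above the truncation level \<open>c\<close>, truncated services exceeding
  \<open>x\<close> in total, the cost \<open>\<epsilon>\<close> of counting, and the drift that is
  left over. Higher moments are taken only of the number of arrivals, so a finite mean service time
  suffices here.\<close>

lemma block_drift:
  assumes \<kappa>: "0 < \<kappa>" and p: "0 \<le> p" "\<And>i. (\<integral>\<^sup>+ \<omega>. ennreal (snd (X i \<omega>)) \<partial>M) \<le> ennreal p"
    and \<epsilon>: "0 \<le> \<epsilon>" "\<epsilon> * (\<mu>' + 1) \<le> \<delta>" and x: "0 < x" and c: "0 \<le> c"
    and \<theta>: "0 \<le> \<theta>" "\<mu>' * \<theta> \<le> \<delta>" "\<And>i. (\<integral>\<^sup>+ \<omega>. ennreal (max 0 (fst (X i \<omega>) - c)) \<partial>M) \<le> ennreal \<theta>"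
    and E: "0 \<le> E" "c\<^sup>2 * E \<le> \<delta> * x" "(\<integral>\<^sup>+ \<omega>. ennreal ((real (A k \<omega>))\<^sup>2) \<partial>M) \<le> ennreal E"
    and drift: "\<mu>' * p + 4 * \<delta> \<le> \<kappa>"
  shows "(\<integral>\<^sup>+ \<omega>. ennreal ((\<Sum>i<A k \<omega>. snd (X (l + i) \<omega>))
          + max 0 ((\<Sum>i<A k \<omega>. fst (X (l + i) \<omega>)) - x) + \<epsilon> * real (A k \<omega> + 1)) \<partial>M) \<le> ennreal (\<kappa> - \<delta>)"
proof -
  define S1 where "S1 \<omega> = (\<Sum>i<A k \<omega>. ennreal (snd (X (l + i) \<omega>)))" for \<omega>
  define S2 where "S2 \<omega> = (\<Sum>i<A k \<omega>. ennreal (max 0 (fst (X (l + i) \<omega>) - c)))" for \<omega>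
  \<comment> \<open>The number of arrivals, written as a block sum so that
    \<open>nn_integral_block_sum\<close> gives its mean.\<close>
  define S3 where "S3 \<omega> = (\<Sum>i<A k \<omega>. (1::ennreal))" for \<omega>
  have [measurable]: "S1 \<in> borel_measurable M" "S2 \<in> borel_measurable M" "S3 \<in> borel_measurable M"
    unfolding S1_def S2_def S3_def
    using block_ennreal_measurable[of "\<lambda>z. ennreal (snd z)" k l]
      block_ennreal_measurable[of "\<lambda>z. ennreal (max 0 (fst z - c))" k l]
      block_ennreal_measurable[of "\<lambda>z. 1" k l] by auto
  have I1: "(\<integral>\<^sup>+ \<omega>. S1 \<omega> \<partial>M) \<le> ennreal \<mu>' * ennreal p"
    unfolding S1_def by (rule nn_integral_block_sum[where g="\<lambda>z. ennreal (snd z)"]) (use p in auto)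
  have I2: "(\<integral>\<^sup>+ \<omega>. S2 \<omega> \<partial>M) \<le> ennreal \<mu>' * ennreal \<theta>"
    unfolding S2_def by (rule nn_integral_block_sum[where g="\<lambda>z. ennreal (max 0 (fst z - c))"]) (use \<theta> in auto)
  have I3: "(\<integral>\<^sup>+ \<omega>. S3 \<omega> \<partial>M) \<le> ennreal \<mu>' * 1"
    unfolding S3_def by (rule nn_integral_block_sum[where g="\<lambda>z. 1"]) (auto simp: emeasure_space_1)
  have "(\<integral>\<^sup>+ \<omega>. ennreal ((\<Sum>i<A k \<omega>. snd (X (l + i) \<omega>))
          + max 0 ((\<Sum>i<A k \<omega>. fst (X (l + i) \<omega>)) - x) + \<epsilon> * real (A k \<omega> + 1)) \<partial>M)
      \<le> (\<integral>\<^sup>+ \<omega>. (S1 \<omega> + S2 \<omega> + ennreal (c\<^sup>2 / x) * ennreal ((real (A k \<omega>))\<^sup>2)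
            + ennreal \<epsilon> * S3 \<omega> + ennreal \<epsilon>) \<partial>M)"
  proof (rule nn_integral_mono)
    fix \<omega> assume \<omega>: "\<omega> \<in> space M"
    define b where "b = A k \<omega>"
    define q where "q i = fst (X (l + i) \<omega>)" for i
    define p' where "p' i = snd (X (l + i) \<omega>)" for i
    have p': "0 \<le> p' i" for i using X_bounds[OF \<omega>, of "l + i"] by (simp add: p'_def)
    have "(\<Sum>i<b. q i) \<le> (\<Sum>i<b. max 0 (q i - c) + c)" by (intro sum_mono) auto
    then have q1: "(\<Sum>i<b. q i) \<le> (\<Sum>i<b. max 0 (q i - c)) + c * real b"
      by (simp add: sum.distrib mult.commute)
    \<comment> \<open>Chebyshev's trick: where \<open>c * real b\<close> exceeds \<open>x\<close>,
      it is at most its square divided by \<open>x\<close>.\<close>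
    have q2: "max 0 (c * real b - x) \<le> c\<^sup>2 / x * (real b)\<^sup>2"
    proof (cases "c * real b \<le> x")
      case False
      then have "x * (c * real b) \<le> (c * real b) * (c * real b)"
        using c by (intro mult_right_mono) auto
      then have "c * real b \<le> c\<^sup>2 / x * (real b)\<^sup>2"
        using x by (simp add: field_simps power2_eq_square)
      then show ?thesis using x False by simp
    qed (use x in simp)
    have "max 0 ((\<Sum>i<b. q i) - x) \<le> (\<Sum>i<b. max 0 (q i - c)) + c\<^sup>2 / x * (real b)\<^sup>2"
      using q1 q2 sum_nonneg[of "{..<b}" "\<lambda>i. max 0 (q i - c)"] by (auto simp: max_def split: if_splits)
    then have "(\<Sum>i<b. p' i) + max 0 ((\<Sum>i<b. q i) - x) + \<epsilon> * real (b + 1)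
        \<le> (\<Sum>i<b. p' i) + (\<Sum>i<b. max 0 (q i - c)) + c\<^sup>2 / x * (real b)\<^sup>2 + \<epsilon> * real b + \<epsilon>"
      by (simp add: algebra_simps)
    then have "ennreal ((\<Sum>i<b. p' i) + max 0 ((\<Sum>i<b. q i) - x) + \<epsilon> * real (b + 1))
        \<le> ennreal ((\<Sum>i<b. p' i) + (\<Sum>i<b. max 0 (q i - c)) + c\<^sup>2 / x * (real b)\<^sup>2 + \<epsilon> * real b + \<epsilon>)"
      by (rule ennreal_leI)
    also have "\<dots> = ennreal (\<Sum>i<b. p' i) + ennreal (\<Sum>i<b. max 0 (q i - c)) + ennreal (c\<^sup>2 / x) * ennreal ((real b)\<^sup>2)
        + ennreal \<epsilon> * ennreal (real b) + ennreal \<epsilon>"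
    proof -
      have "ennreal (s1 + s2 + \<alpha> * \<beta> + \<epsilon> * \<gamma> + \<epsilon>) = ennreal s1 + ennreal s2 + ennreal \<alpha> * ennreal \<beta>
          + ennreal \<epsilon> * ennreal \<gamma> + ennreal \<epsilon>"
        if "0 \<le> s1" "0 \<le> s2" "0 \<le> \<alpha>" "0 \<le> \<beta>" "0 \<le> \<gamma>" for s1 s2 \<alpha> \<beta> \<gamma>
        using that \<epsilon>(1) by (simp add: ennreal_plus ennreal_mult')
      then show ?thesis using p' x by (simp only: sum_nonneg zero_le_power2 max.cobounded1
          divide_nonneg_pos of_nat_0_le_iff)
    qed
    also have "\<dots> = S1 \<omega> + S2 \<omega> + ennreal (c\<^sup>2 / x) * ennreal ((real (A k \<omega>))\<^sup>2)
            + ennreal \<epsilon> * S3 \<omega> + ennreal \<epsilon>"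
    proof -
      have "ennreal (\<Sum>i<b. p' i) = S1 \<omega>"
        using p' by (simp add: S1_def b_def p'_def sum_ennreal)
      moreover have "ennreal (\<Sum>i<b. max 0 (q i - c)) = S2 \<omega>"
        unfolding S2_def b_def[symmetric] q_def by (rule sum_ennreal[symmetric]) simp
      moreover have "ennreal (real b) = S3 \<omega>"
        by (simp add: S3_def b_def ennreal_of_nat_eq_real_of_nat)
      ultimately show ?thesis by (simp only: b_def)
    qed
    finally show "ennreal ((\<Sum>i<A k \<omega>. snd (X (l + i) \<omega>))
          + max 0 ((\<Sum>i<A k \<omega>. fst (X (l + i) \<omega>)) - x) + \<epsilon> * real (A k \<omega> + 1))
      \<le> S1 \<omega> + S2 \<omega> + ennreal (c\<^sup>2 / x) * ennreal ((real (A k \<omega>))\<^sup>2) + ennreal \<epsilon> * S3 \<omega> + ennreal \<epsilon>"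
      by (simp only: b_def q_def p'_def)
  qed
  also have "\<dots> = (\<integral>\<^sup>+ \<omega>. S1 \<omega> \<partial>M) + (\<integral>\<^sup>+ \<omega>. S2 \<omega> \<partial>M)
      + ennreal (c\<^sup>2 / x) * (\<integral>\<^sup>+ \<omega>. ennreal ((real (A k \<omega>))\<^sup>2) \<partial>M)
      + ennreal \<epsilon> * (\<integral>\<^sup>+ \<omega>. S3 \<omega> \<partial>M) + ennreal \<epsilon>"
    by (simp add: nn_integral_add nn_integral_cmult emeasure_space_1)
  also have "\<dots> \<le> ennreal \<mu>' * ennreal p + ennreal \<mu>' * ennreal \<theta> + ennreal (c\<^sup>2 / x) * ennreal E
      + ennreal \<epsilon> * (ennreal \<mu>' * 1) + ennreal \<epsilon>"
    by (intro add_mono mult_left_mono I1 I2 I3 E order_refl) auto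
  also have "\<dots> = ennreal (\<mu>' * p + \<mu>' * \<theta> + c\<^sup>2 / x * E + \<epsilon> * \<mu>' + \<epsilon>)"
  proof -
    have "ennreal \<mu>' * ennreal p + ennreal \<mu>' * ennreal \<theta> + ennreal \<alpha> * ennreal E
        + ennreal \<epsilon> * (ennreal \<mu>' * 1) + ennreal \<epsilon>
      = ennreal (\<mu>' * p + \<mu>' * \<theta> + \<alpha> * E + \<epsilon> * \<mu>' + \<epsilon>)" if "0 \<le> \<alpha>" for \<alpha>
      using that p(1) \<theta>(1) E(1) \<epsilon>(1) \<mu>'_nonneg by (simp add: ennreal_plus ennreal_mult')
    then show ?thesis using x by simp
  qed
  also have "\<dots> \<le> ennreal (\<kappa> - \<delta>)"
  proof (rule ennreal_leI)
    have "c\<^sup>2 / x * E \<le> \<delta>" using E(2) x by (simp add: field_simps)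
    moreover have "\<epsilon> * \<mu>' + \<epsilon> \<le> \<delta>" using \<epsilon>(2) by (simp add: distrib_left)
    ultimately show "\<mu>' * p + \<mu>' * \<theta> + c\<^sup>2 / x * E + \<epsilon> * \<mu>' + \<epsilon> \<le> \<kappa> - \<delta>"
      using \<theta>(2) drift by linarith
  qed
  finally show ?thesis .
qed

text \<open>The constants can be chosen without circularity: \<open>\<delta>\<close> from the drift
  gap, then \<open>c\<close>, then \<open>J\<close>, and \<open>z\<close> last. The block moment
  \<open>K\<close> involves none of \<open>J\<close>, \<open>\<epsilon>\<close> and
  \<open>z\<close>.\<close>

lemma bound_count_moment_finite:
  assumes \<kappa>: "0 < \<kappa>" and w: "0 \<le> w"
    and p: "0 \<le> p" "\<And>i. (\<integral>\<^sup>+ \<omega>. ennreal (snd (X i \<omega>)) \<partial>M) \<le> ennreal p" "\<mu>' * p < \<kappa>"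
    and e: "0 \<le> e" "\<And>i. (\<integral>\<^sup>+ \<omega>. ennreal (fst (X i \<omega>) ^ Suc n) \<partial>M) \<le> ennreal e"
    and ui: "\<And>\<theta>. 0 < \<theta> \<Longrightarrow> \<exists>c\<ge>0. \<forall>i. (\<integral>\<^sup>+ \<omega>. ennreal (max 0 (fst (X i \<omega>) - c)) \<partial>M) \<le> ennreal \<theta>"
  shows "(\<integral>\<^sup>+ \<omega>. (SUP k. of_nat (bound_count \<kappa> w (\<lambda>j. A j \<omega>) (\<lambda>i. X i \<omega>) k)) ^ Suc n \<partial>M) < \<infinity>"
proof -
  \<comment> \<open>A quarter of the gap, for the four shares in \<open>block_drift\<close>.\<close>
  define \<delta> where "\<delta> = (\<kappa> - \<mu>' * p) / 4"
  have \<delta>: "0 < \<delta>" using p by (simp add: \<delta>_def)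
  have drift: "\<mu>' * p + 4 * \<delta> \<le> \<kappa>" by (simp add: \<delta>_def field_simps)
  have \<mu>1: "0 < \<mu>' + 1" using \<mu>'_nonneg by simp
  define \<theta> where "\<theta> = \<delta> / (\<mu>' + 1)"
  have \<theta>: "0 < \<theta>" "\<theta> * (\<mu>' + 1) = \<delta>" using \<delta> \<mu>1 by (auto simp: \<theta>_def)
  obtain c where c: "0 \<le> c" "\<And>i. (\<integral>\<^sup>+ \<omega>. ennreal (max 0 (fst (X i \<omega>) - c)) \<partial>M) \<le> ennreal \<theta>"
    using ui[OF \<theta>(1)] by auto
  obtain E where E: "0 \<le> E" "\<And>k. (\<integral>\<^sup>+ \<omega>. ennreal ((real (A k \<omega>))\<^sup>2) \<partial>M) \<le> ennreal E"
    using arrivals_square_bounded by blast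
  \<comment> \<open>Makes \<open>x = \<kappa> * real J - w - \<kappa>\<close> at least
    \<open>1 + c\<^sup>2 * E / \<delta>\<close>, hence positive and large enough for the
    second-moment bound on the arrivals.\<close>
  obtain J where J: "(w + \<kappa> + 1 + c\<^sup>2 * E / \<delta>) / \<kappa> < real J"
    using reals_Archimedean2 by blast
  define x where "x = \<kappa> * real J - w - \<kappa>"
  have x: "1 + c\<^sup>2 * E / \<delta> \<le> x" using J \<kappa> by (simp add: x_def field_simps)
  have cE: "0 \<le> c\<^sup>2 * E / \<delta>" using E \<delta> by simp
  have x0: "0 < x" using x cE by linarith
  have "c\<^sup>2 * E / \<delta> \<le> x" using x by linarith
  then have xE: "c\<^sup>2 * E \<le> \<delta> * x" using \<delta> by (simp add: field_simps)
  have J1: "1 \<le> J" "w + \<kappa> \<le> \<kappa> * real J" using x0 \<kappa> w by (cases J; simp add: x_def)+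
  define \<epsilon> where "\<epsilon> = min 1 \<theta>"
  have \<epsilon>: "0 < \<epsilon>" "\<epsilon> \<le> 1" "\<epsilon> * (\<mu>' + 1) \<le> \<delta>"
    using \<theta> \<mu>1 mult_right_mono[of \<epsilon> \<theta> "\<mu>' + 1"] by (auto simp: \<epsilon>_def)
  obtain K where K: "0 \<le> K"
    "\<And>k l. (\<integral>\<^sup>+ \<omega>. ennreal ((2 + \<kappa> + real (A k \<omega>) + 2 * (\<Sum>i<A k \<omega>. fst (X (l + i) \<omega>))) ^ Suc n) \<partial>M) \<le> ennreal K"
    using block_moment_bounded[of "2 + \<kappa>" e n] \<kappa> e by auto
  define r where "r = exp (- \<mu>') / 2"
  have "exp (- \<mu>') \<le> 1" using \<mu>'_nonneg by simp
  then have r: "0 < r" "r \<le> 1" unfolding r_def by (simp, linarith)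
  define z where "z = max 1 (max (2 * K / r ^ J) (K / (real (Suc n) * \<delta>)))"
  have "0 < r ^ J" "0 < real (Suc n) * \<delta>" using r \<delta> by auto
  moreover have z: "1 \<le> z" "2 * K / r ^ J \<le> z" "K / (real (Suc n) * \<delta>) \<le> z" by (auto simp: z_def)
  ultimately have zK: "2 * K \<le> z * r ^ J" "K \<le> z * (real (Suc n) * \<delta>)"
    by (auto simp: divide_le_eq)
  define C D where "C = (\<lambda>k \<omega>. bound_count \<kappa> w (\<lambda>j. A j \<omega>) (\<lambda>i. X i \<omega>) k)"
    and "D = (\<lambda>k \<omega>. bound_chain \<kappa> w (\<lambda>j. A j \<omega>) (\<lambda>i. X i \<omega>) k)"
  let ?V = "lyapunov n z \<epsilon> r J \<kappa>"
  define B where "B = ?V 0 \<kappa>"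
  have \<mu>\<theta>: "\<mu>' * \<theta> \<le> \<delta>" using \<theta> \<mu>'_nonneg by (simp add: algebra_simps)
  have \<delta>\<kappa>: "\<delta> \<le> \<kappa>" using drift \<delta> p(1) \<mu>'_nonneg mult_nonneg_nonneg[of \<mu>' p] by linarith
  have V_le: "(\<integral>\<^sup>+ \<omega>. ennreal (?V (C k \<omega>) (D k \<omega>)) \<partial>M) \<le> ennreal B" for k
  proof (induction k)
    case 0
    then show ?case by (simp add: C_def D_def B_def emeasure_space_1)
  next
    case (Suc k)
    have "(\<integral>\<^sup>+ \<omega>. ennreal (?V (C (Suc k) \<omega>) (D (Suc k) \<omega>)) \<partial>M) \<le> (\<integral>\<^sup>+ \<omega>. ennreal (?V (C k \<omega>) (D k \<omega>)) \<partial>M)"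
      unfolding C_def D_def
    proof (rule chain_expectation_le[where f="\<lambda>c d. ennreal (?V c d)", OF _ \<kappa> w])
      show "(\<lambda>d. ennreal (?V c d)) \<in> borel_measurable borel" for c
        using lyapunov_measurable by measurable
      show "(\<integral>\<^sup>+ \<omega>. ennreal (?V (c + (if d = 0 then 0 else A k \<omega> + 1))
          (bound_step \<kappa> w (A k \<omega>) (\<Sum>i<A k \<omega>. fst (X (l + i) \<omega>)) (\<Sum>i<A k \<omega>. snd (X (l + i) \<omega>)) d)) \<partial>M)
        \<le> ennreal (?V c d)" if "0 \<le> d" for c d l
        unfolding r_def
      proof (rule lyapunov_expected_step[OF \<kappa> w \<epsilon>(1,2) z(1) J1 K \<delta>\<kappa> _ zK[unfolded r_def] that])
        show "(\<integral>\<^sup>+ \<omega>. ennreal ((\<Sum>i<A k \<omega>. snd (X (l + i) \<omega>))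
          + max 0 ((\<Sum>i<A k \<omega>. fst (X (l + i) \<omega>)) - (\<kappa> * real J - w - \<kappa>))
          + \<epsilon> * real (A k \<omega> + 1)) \<partial>M) \<le> ennreal (\<kappa> - \<delta>)"
          unfolding x_def[symmetric]
          using \<epsilon> \<theta> by (intro block_drift[OF \<kappa> p(1,2) _ \<epsilon>(3) x0 c(1) _ \<mu>\<theta> c(2) E(1) xE E(2) drift]) auto
      qed
    qed
    then show ?case using Suc by (rule order_trans)
  qed
  have [measurable]: "C k \<in> measurable M (count_space UNIV)" for k
    unfolding C_def using measurable_compose[OF AX_measurable bound_count_measurable] by simp
  have C_le: "(\<integral>\<^sup>+ \<omega>. (of_nat (C k \<omega>) :: ennreal) ^ Suc n \<partial>M) \<le> ennreal ((1 / \<epsilon>) ^ Suc n * B)" for k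
  proof -
    have "(\<integral>\<^sup>+ \<omega>. (of_nat (C k \<omega>) :: ennreal) ^ Suc n \<partial>M)
        \<le> (\<integral>\<^sup>+ \<omega>. ennreal ((1 / \<epsilon>) ^ Suc n) * ennreal (?V (C k \<omega>) (D k \<omega>)) \<partial>M)"
    proof (rule nn_integral_mono)
      fix \<omega> assume \<omega>: "\<omega> \<in> space M"
      have D0: "0 \<le> D k \<omega>"
        unfolding D_def using X_bounds[OF \<omega>] by (intro bound_chain_nonneg \<kappa> w) (meson order_trans)
      \<comment> \<open>The weight is at least 1 and \<open>z\<close>, \<open>D\<close> are
        nonnegative, so the Lyapunov function controls the count.\<close>
      have "(\<epsilon> * real (C k \<omega>)) ^ Suc n * 1 \<le> ?V (C k \<omega>) (D k \<omega>)"
        unfolding lyapunov_def using D0 z \<epsilon> r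
        by (intro mult_mono power_mono level_weight_bounds) auto
      then have "(1 / \<epsilon>) ^ Suc n * (\<epsilon> * real (C k \<omega>)) ^ Suc n \<le> (1 / \<epsilon>) ^ Suc n * ?V (C k \<omega>) (D k \<omega>)"
        using \<epsilon> by (intro mult_left_mono) auto
      also have "(1 / \<epsilon>) ^ Suc n * (\<epsilon> * real (C k \<omega>)) ^ Suc n = real (C k \<omega>) ^ Suc n"
        using \<epsilon> by (simp only: power_mult_distrib[symmetric]) simp
      finally have "ennreal (real (C k \<omega>) ^ Suc n) \<le> ennreal ((1 / \<epsilon>) ^ Suc n * ?V (C k \<omega>) (D k \<omega>))"
        by (rule ennreal_leI)
      moreover have "(of_nat (C k \<omega>) :: ennreal) ^ Suc n = ennreal (real (C k \<omega>) ^ Suc n)"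
        by (simp only: ennreal_of_nat_eq_real_of_nat ennreal_power of_nat_0_le_iff)
      moreover have "ennreal ((1 / \<epsilon>) ^ Suc n * ?V (C k \<omega>) (D k \<omega>))
          = ennreal ((1 / \<epsilon>) ^ Suc n) * ennreal (?V (C k \<omega>) (D k \<omega>))"
        using \<epsilon> by (intro ennreal_mult') auto
      ultimately show "(of_nat (C k \<omega>) :: ennreal) ^ Suc n \<le> ennreal ((1 / \<epsilon>) ^ Suc n) * ennreal (?V (C k \<omega>) (D k \<omega>))"
        by (simp only:)
    qed
    also have "\<dots> = ennreal ((1 / \<epsilon>) ^ Suc n) * (\<integral>\<^sup>+ \<omega>. ennreal (?V (C k \<omega>) (D k \<omega>)) \<partial>M)"
    proof (rule nn_integral_cmult)
      have [measurable]: "D k \<in> borel_measurable M"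
        unfolding D_def using measurable_compose[OF AX_measurable bound_chain_measurable] by simp
      have "(\<lambda>\<omega>. ?V (C k \<omega>) (D k \<omega>)) \<in> borel_measurable M"
        by (rule measurable_compose_countable[where f="\<lambda>c \<omega>. ?V c (D k \<omega>)"])
           (auto intro!: measurable_compose[OF _ lyapunov_measurable])
      then show "(\<lambda>\<omega>. ennreal (?V (C k \<omega>) (D k \<omega>))) \<in> borel_measurable M" by measurable
    qed
    also have "\<dots> \<le> ennreal ((1 / \<epsilon>) ^ Suc n) * ennreal B"
      by (intro mult_left_mono V_le) auto
    also have "\<dots> = ennreal ((1 / \<epsilon>) ^ Suc n * B)"
      using \<epsilon> by (intro ennreal_mult'[symmetric]) auto
    finally show ?thesis .
  qed
  have "(\<integral>\<^sup>+ \<omega>. (SUP k. of_nat (C k \<omega>)) ^ Suc n \<partial>M) \<le> (\<integral>\<^sup>+ \<omega>. (SUP k. (of_nat (C k \<omega>) :: ennreal) ^ Suc n) \<partial>M)"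
    by (intro nn_integral_mono SUP_power_le_ennreal) (auto simp: incseq_def C_def bound_count_mono)
  also have "\<dots> = (SUP k. \<integral>\<^sup>+ \<omega>. (of_nat (C k \<omega>) :: ennreal) ^ Suc n \<partial>M)"
  proof (rule nn_integral_monotone_convergence_SUP)
    show "incseq (\<lambda>k \<omega>. (of_nat (C k \<omega>) :: ennreal) ^ Suc n)"
      unfolding incseq_def le_fun_def
      by (intro allI impI power_mono_ennreal) (simp add: C_def bound_count_mono)
    show "(\<lambda>\<omega>. (of_nat (C k \<omega>) :: ennreal) ^ Suc n) \<in> borel_measurable M" for k
      by measurable
  qed
  also have "\<dots> \<le> ennreal ((1 / \<epsilon>) ^ Suc n * B)"
    by (intro SUP_least C_le)
  also have "\<dots> < \<infinity>" by simp
  finally show ?thesis unfolding C_def .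
qed

end

section \<open>Service and patience times\<close>

lemma interval_measure_cdf:
  assumes "real_distribution D"
  shows "interval_measure (cdf D) = D"
proof -
  interpret real_distribution D by fact
  have mono: "cdf D x \<le> cdf D y" if "x \<le> y" for x y using that by (rule cdf_nondecreasing)
  have "real_distribution (interval_measure (cdf D))"
    using cdf_is_right_cont cdf_lim_at_bot cdf_lim_at_top_prob
    by (intro real_distribution_interval_measure mono) auto
  moreover have "cdf (interval_measure (cdf D)) = cdf D"
    using cdf_is_right_cont cdf_lim_at_bot by (intro cdf_interval_measure mono) auto
  ultimately show ?thesis using assms by (intro cdf_unique)
qed

text \<open>Lets integrals against \<open>interval_measure G\<close> be read as expectations of a
  service time.\<close>

lemma (in prob_space) distr_eq_interval_measure:
  assumes [measurable]: "X \<in> borel_measurable M"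
    and G: "\<And>s. G s = prob {\<omega> \<in> space M. X \<omega> \<le> s}"
  shows "interval_measure G = distr M borel X"
proof -
  have "cdf (distr M borel X) = G"
    by (auto simp: fun_eq_iff cdf_def measure_distr G intro!: arg_cong[where f=prob])
  then show ?thesis
    using interval_measure_cdf[OF real_distribution_distr[of X]] by simp
qed

text \<open>The law of \<open>X\<close> restricted to \<open>E\<close> and \<open>prob E\<close>
  times the law of \<open>X\<close> are finite measures with the same distribution function, hence
  equal. Thus factorization on half-lines is enough.\<close>

lemma (in prob_space) nn_integral_indicator_indep_cdf:
  fixes X :: "'a \<Rightarrow> real"
  assumes X [measurable]: "X \<in> borel_measurable M" and E [measurable]: "E \<in> events"
    and h [measurable]: "h \<in> borel_measurable borel"
    and ind: "\<And>s. prob ({\<omega> \<in> space M. X \<omega> \<le> s} \<inter> E) = prob {\<omega> \<in> space M. X \<omega> \<le> s} * prob E"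
  shows "(\<integral>\<^sup>+ \<omega>. h (X \<omega>) * indicator E \<omega> \<partial>M) = ennreal (prob E) * (\<integral>\<^sup>+ \<omega>. h (X \<omega>) \<partial>M)"
proof -
  define M1 where "M1 = distr (density M (indicator E)) borel X"
  define M2 where "M2 = scale_measure (ennreal (prob E)) (distr M borel X)"
  have em1: "emeasure M1 B = emeasure M ((X -` B \<inter> space M) \<inter> E)" if "B \<in> sets borel" for B
  proof -
    have [measurable]: "B \<in> sets borel" by fact
    have "emeasure M1 B = emeasure (density M (indicator E)) (X -` B \<inter> space M)"
      unfolding M1_def by (subst emeasure_distr) auto
    also have "\<dots> = (\<integral>\<^sup>+ \<omega>. indicator E \<omega> * indicator (X -` B \<inter> space M) \<omega> \<partial>M)"
      by (rule emeasure_density) measurable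
    also have "\<dots> = (\<integral>\<^sup>+ \<omega>. indicator ((X -` B \<inter> space M) \<inter> E) \<omega> \<partial>M)"
      by (intro nn_integral_cong) (simp split: split_indicator)
    also have "\<dots> = emeasure M ((X -` B \<inter> space M) \<inter> E)"
      by (rule nn_integral_indicator) measurable
    finally show ?thesis .
  qed
  have em2: "emeasure M2 B = ennreal (prob E) * emeasure M (X -` B \<inter> space M)" if "B \<in> sets borel" for B
    unfolding M2_def using that by (simp add: emeasure_distr)
  have "M1 = M2"
  proof (rule cdf_unique')
    have sp: "space M1 = UNIV" "space M2 = UNIV" and "sets M1 = sets borel" "sets M2 = sets borel"
      by (auto simp: M1_def M2_def space_scale_measure)
    moreover have "emeasure M1 UNIV \<noteq> \<infinity>" "emeasure M2 UNIV \<noteq> \<infinity>"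
      by (auto simp: em1 em2 emeasure_eq_measure ennreal_mult_eq_top_iff)
    ultimately show "finite_borel_measure M1" "finite_borel_measure M2"
      by (auto intro!: finite_borel_measure.intro finite_borel_measure_axioms.intro finite_measureI)
    have "{\<omega> \<in> space M. X \<omega> \<le> s} = X -` {..s} \<inter> space M" for s by auto
    then have "emeasure M1 {..s} = emeasure M2 {..s}" for s
      using ind[of s] by (simp add: em1 em2 emeasure_eq_measure ennreal_mult' mult.commute)
    then show "cdf M1 = cdf M2" by (simp add: cdf_def measure_def fun_eq_iff)
  qed
  moreover have "(\<integral>\<^sup>+ x. h x \<partial>M1) = (\<integral>\<^sup>+ \<omega>. h (X \<omega>) * indicator E \<omega> \<partial>M)"
    unfolding M1_def by (simp add: nn_integral_distr nn_integral_density mult.commute)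
  moreover have "(\<integral>\<^sup>+ x. h x \<partial>M2) = ennreal (prob E) * (\<integral>\<^sup>+ \<omega>. h (X \<omega>) \<partial>M)"
    unfolding M2_def by (simp add: nn_integral_scale_measure nn_integral_distr)
  ultimately show ?thesis by simp
qed

text \<open>\<open>Lim\<close> is meaningful only where a limit exists; monotonicity and the lower
  bound supply it as the infimum.\<close>

lemma antimono_bounded_below_tendsto_Lim:
  fixes f :: "real \<Rightarrow> real"
  assumes mono: "\<And>x y. x \<le> y \<Longrightarrow> f y \<le> f x" and bd: "\<And>x. b \<le> f x"
  shows "(f \<longlongrightarrow> Lim at_top f) at_top"
proof -
  have bdd: "bdd_below (range f)" using bd by (intro bdd_belowI[of _ b]) auto
  have "(f \<longlongrightarrow> (INF x. f x)) at_top"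
  proof (rule decreasing_tendsto)
    show "\<forall>\<^sub>F x in at_top. (INF x. f x) \<le> f x"
      using bdd by (intro always_eventually allI cINF_lower) auto
    fix u assume "(INF x. f x) < u"
    then obtain x where "f x < u" using cINF_less_iff[of UNIV f u] bdd by auto
    then show "\<forall>\<^sub>F x in at_top. f x < u"
      using mono unfolding eventually_at_top_linorder by (meson le_less_trans)
  qed
  then show ?thesis by (simp add: tendsto_Lim)
qed

text \<open>\<open>ennreal\<close> maps negative reals to 0, so the integrand is the positive part.
  It vanishes once \<open>c\<close> exceeds \<open>X \<omega>\<close> and is dominated by
  \<open>X\<close>.\<close>

lemma (in prob_space) excess_integral_tendsto_0:
  fixes X :: "'a \<Rightarrow> real"
  assumes [measurable]: "X \<in> borel_measurable M"
    and fin: "(\<integral>\<^sup>+ \<omega>. ennreal (X \<omega>) \<partial>M) < \<infinity>"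
  shows "(\<lambda>c::nat. \<integral>\<^sup>+ \<omega>. ennreal (X \<omega> - real c) \<partial>M) \<longlonglongrightarrow> 0"
proof -
  have "(\<lambda>c::nat. \<integral>\<^sup>+ \<omega>. ennreal (X \<omega> - real c) \<partial>M) \<longlonglongrightarrow> (\<integral>\<^sup>+ \<omega>. 0 \<partial>M)"
  proof (rule nn_integral_dominated_convergence[where w="\<lambda>\<omega>. ennreal (X \<omega>)"])
    have "(\<lambda>c. ennreal (X \<omega> - real c)) \<longlonglongrightarrow> 0" for \<omega>
    proof (rule tendsto_eventually)
      obtain c0 :: nat where "X \<omega> \<le> real c0" using real_arch_simple by blast
      then show "\<forall>\<^sub>F c in sequentially. ennreal (X \<omega> - real c) = 0"
        unfolding eventually_sequentially by (intro exI[of _ c0]) (auto simp: ennreal_eq_0_iff)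
    qed
    then show "AE \<omega> in M. (\<lambda>c. ennreal (X \<omega> - real c)) \<longlonglongrightarrow> 0" by simp
  qed (use fin in \<open>auto intro!: ennreal_leI\<close>)
  then show ?thesis by simp
qed

text \<open>If the integral does not exist, \<open>integral\<close> has the default value 0, which
  obeys both bounds.\<close>

lemma integral_bounds:
  fixes f :: "real \<Rightarrow> real"
  assumes "a \<le> b" "\<And>t. 0 \<le> f t" "\<And>t. f t \<le> L"
  shows "0 \<le> integral {a..b} f" "integral {a..b} f \<le> L * (b - a)"
proof -
  have L: "0 \<le> L" using assms order_trans by blast
  show "0 \<le> integral {a..b} f"
    using assms by (cases "f integrable_on {a..b}") (auto intro: integral_nonneg simp: not_integrable_integral)
  show "integral {a..b} f \<le> L * (b - a)"
  proof (cases "f integrable_on {a..b}")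
    case True
    then have "integral {a..b} f \<le> integral {a..b} (\<lambda>_. L)"
      using assms by (intro integral_le) auto
    then show ?thesis using assms by (simp add: mult.commute)
  next
    case False
    then show ?thesis using assms L by (simp add: not_integrable_integral)
  qed
qed

theorem theorem6:
  fixes M :: "'a measure"
    and lam :: "real \<Rightarrow> real" and \<kappa> lamh :: real
    and N :: "real \<Rightarrow> 'a \<Rightarrow> nat"
    and S :: "nat \<Rightarrow> 'a \<Rightarrow> real" and Y :: "nat \<Rightarrow> 'a \<Rightarrow> ennreal"
    and G H :: "real \<Rightarrow> real" and \<Psi> :: "real \<Rightarrow> real \<Rightarrow> real"
    and m :: nat
  assumes P: "prob_space M"
    and lam_borel: "lam \<in> borel_measurable borel"
    and kappa_pos: "\<kappa> > 0"
    and lam_periodic: "\<And>t. lam (t + \<kappa>) = lam t"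
    and lamh_pos: "0 < lamh"
    and lam_bounds: "\<And>t. 0 \<le> lam t \<and> lam t \<le> lamh"
    and arrivals: "inhom_poisson_process M lam N"
    and S_meas: "\<And>i. S i \<in> borel_measurable M"
    and Y_meas: "\<And>i. Y i \<in> borel_measurable M"
    and marks_iid_indep: "prob_space.indep_vars M (\<lambda>_. borel \<Otimes>\<^sub>M borel) (\<lambda>i \<omega>. (S i \<omega>, Y i \<omega>)) UNIV"
    and marks_cdf: "\<And>i s y. measure M {\<omega>\<in>space M. S i \<omega> \<le> s \<and> Y i \<omega> \<le> ennreal y} = \<Psi> s y"
    and support_S: "\<And>i. AE \<omega> in M. 0 < S i \<omega>"
    and support_Y: "\<And>i. AE \<omega> in M. 0 < Y i \<omega>"
    and G_cdf: "\<And>i s. G s = measure M {\<omega>\<in>space M. S i \<omega> \<le> s}"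
    and H_cdf: "\<And>i y. H y = measure M {\<omega>\<in>space M. Y i \<omega> \<le> ennreal y}"
    and arrivals_marks_indep:
      "prob_space.indep_set M
         (sets (vimage_algebra (space M) (\<lambda>\<omega> t. N t \<omega>) (Pi\<^sub>M UNIV (\<lambda>_. count_space UNIV))))
         (sets (vimage_algebra (space M) (\<lambda>\<omega> i. (S i \<omega>, Y i \<omega>)) (Pi\<^sub>M UNIV (\<lambda>_. borel \<Otimes>\<^sub>M borel))))"
    and product_form: "\<And>s y. \<Psi> s y = G s * H y"
    and mean_finite: "(\<integral>\<^sup>+ x. ennreal x * indicator {0..} x \<partial>interval_measure G) < \<infinity>"
    and stability: "lamh * enn2real (\<integral>\<^sup>+ x. ennreal x * indicator {0..} x \<partial>interval_measure G)
                      * Lim at_top (\<lambda>y. 1 - H y) < 1"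
  shows "(m = 1 \<longrightarrow>
            (\<integral>\<^sup>+ \<omega>. eta_star \<kappa> (\<lambda>t. N t \<omega>) (\<lambda>i. S i \<omega>) (\<lambda>i. Y i \<omega>) \<partial>M) < \<infinity>)
         \<and> (m \<ge> 2 \<and>
            (\<integral>\<^sup>+ x. ennreal (x ^ m) * indicator {0..} x \<partial>interval_measure G) < \<infinity> \<longrightarrow>
            (\<integral>\<^sup>+ \<omega>. eta_star \<kappa> (\<lambda>t. N t \<omega>) (\<lambda>i. S i \<omega>) (\<lambda>i. Y i \<omega>) ^ m \<partial>M) < \<infinity>)"
proof -
  interpret prob_space M by (rule P)
  note S_meas [measurable] Y_meas [measurable]
  have N_meas [measurable]: "N t \<in> measurable M (count_space UNIV)" for t
    using arrivals by (auto simp: inhom_poisson_process_def)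
  have path: "counting_path (\<lambda>t. N t \<omega>)" if "\<omega> \<in> space M" for \<omega>
    using arrivals that by (simp add: inhom_poisson_process_def counting_path_def)
  have marginal: "interval_measure G = distr M borel (S i)" for i
    by (rule distr_eq_interval_measure[OF S_meas G_cdf])
  have IG: "(\<integral>\<^sup>+ x. h x \<partial>interval_measure G) = (\<integral>\<^sup>+ \<omega>. h (S i \<omega>) \<partial>M)"
    if "h \<in> borel_measurable borel" for h i
    unfolding marginal[of i] using that by (simp add: nn_integral_distr)
  define sbar where "sbar = enn2real (\<integral>\<^sup>+ x. ennreal x * indicator {0..} x \<partial>interval_measure G)"
  have sbar0: "0 \<le> sbar" by (simp add: sbar_def)
  have sbar: "(\<integral>\<^sup>+ \<omega>. ennreal (max 0 (S i \<omega>)) \<partial>M) = ennreal sbar" for i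
  proof -
    have "(\<integral>\<^sup>+ \<omega>. ennreal (max 0 (S i \<omega>)) \<partial>M) = (\<integral>\<^sup>+ x. ennreal (max 0 x) \<partial>interval_measure G)"
      by (rule IG[symmetric]) measurable
    also have "\<dots> = (\<integral>\<^sup>+ x. ennreal x * indicator {0..} x \<partial>interval_measure G)"
      by (intro nn_integral_cong) (auto simp: indicator_def max_def ennreal_neg)
    also have "\<dots> = ennreal sbar"
      using mean_finite by (simp add: sbar_def)
    finally show ?thesis .
  qed

  define T where "T y = 1 - H y" for y
  have T_prob: "T y = prob {\<omega> \<in> space M. ennreal y < Y i \<omega>}" for y i
  proof -
    have "prob {\<omega> \<in> space M. \<not> Y i \<omega> \<le> ennreal y} = 1 - prob {\<omega> \<in> space M. Y i \<omega> \<le> ennreal y}"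
      by (rule prob_neg) measurable
    then show ?thesis by (simp add: T_def H_cdf[of y i] not_le)
  qed
  have T_mono: "T y' \<le> T y" if "y \<le> y'" for y y'
    unfolding T_prob[of _ 0] using that
    by (intro finite_measure_mono) (auto intro: le_less_trans[OF ennreal_leI])
  have "(T \<longlongrightarrow> Lim at_top T) at_top"
    by (rule antimono_bounded_below_tendsto_Lim[of T 0, OF T_mono]) (auto simp: T_prob[of _ 0])
  then have "((\<lambda>y. lamh * sbar * T y) \<longlongrightarrow> lamh * sbar * Lim at_top T) at_top"
    by (intro tendsto_intros)
  moreover have "lamh * sbar * Lim at_top T < 1"
    using stability by (simp add: sbar_def T_def[abs_def])
  \<comment> \<open>The strict inequality at the limit already holds at some finite patience level
    \<open>y0\<close>.\<close>
  ultimately have "\<forall>\<^sub>F y in at_top. lamh * sbar * T y < 1"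
    by (rule order_tendstoD)
  then have "\<forall>\<^sub>F y in at_top. 0 \<le> y \<and> lamh * sbar * T y < 1"
    using eventually_ge_at_top[of 0] by eventually_elim simp
  then obtain y0 where y0: "0 \<le> y0" "lamh * sbar * T y0 < 1"
    using eventually_happens by force

  define A where "A k \<omega> = N (\<kappa> * real (Suc k)) \<omega> - N (\<kappa> * real k) \<omega>" for k \<omega>
  \<comment> \<open>Services are positive only almost surely. Clipping at 0 gives the sign
    conditions on marks at every sample point.\<close>
  define mark where "mark z = (max 0 (fst z), if ennreal y0 < snd z then max 0 (fst z) else 0 :: real)"
    for z :: "real \<times> ennreal"
  define X where "X i \<omega> = mark (S i \<omega>, Y i \<omega>)" for i \<omega>
  define \<mu> where "\<mu> k = integral {\<kappa> * real k..\<kappa> * real (Suc k)} lam" for k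
  have mark_meas [measurable]: "mark \<in> measurable (borel \<Otimes>\<^sub>M borel) borel"
    unfolding mark_def[abs_def] borel_prod[symmetric] by measurable
  have grid: "0 \<le> \<kappa> * real k" "\<kappa> * real k \<le> \<kappa> * real (Suc k)" "\<kappa> * real (Suc k) - \<kappa> * real k = \<kappa>" for k
    using kappa_pos by (auto simp: algebra_simps)

  interpret marked_blocks M A X \<mu> "lamh * \<kappa>"
  proof
    show "indep_vars (\<lambda>_. count_space UNIV) A {..<K}" for K
    proof -
      have "indep_vars (\<lambda>_. count_space UNIV)
          (\<lambda>j \<omega>. N (\<kappa> * real (Suc j)) \<omega> - N (\<kappa> * real j) \<omega>) {..<K}"
        using arrivals grid unfolding inhom_poisson_process_def
        by (elim conjE allE[of _ "\<lambda>j. \<kappa> * real j"] allE[of _ K]) (auto simp del: of_nat_Suc)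
      then show ?thesis by (simp add: A_def[abs_def])
    qed
    show "indep_vars (\<lambda>_. borel) X UNIV"
      unfolding X_def[abs_def]
      by (rule indep_vars_compose2[OF marks_iid_indep, of "\<lambda>_. mark" "\<lambda>_. borel"]) (rule mark_meas)
    show "indep_pair (Pi\<^sub>M UNIV (\<lambda>_. count_space UNIV)) (\<lambda>\<omega> k. A k \<omega>) (Pi\<^sub>M UNIV (\<lambda>_. borel)) (\<lambda>\<omega> i. X i \<omega>)"
    proof -
      have "indep_pair (Pi\<^sub>M UNIV (\<lambda>_. count_space UNIV)) (\<lambda>\<omega> t. N t \<omega>)
          (Pi\<^sub>M UNIV (\<lambda>_. borel \<Otimes>\<^sub>M borel)) (\<lambda>\<omega> i. (S i \<omega>, Y i \<omega>))"
        using arrivals_marks_indep unfolding indep_pair_def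
        by (subst (asm) (1 2) sets_vimage_algebra2)
           (auto simp: space_PiM space_pair_measure intro!: measurable_PiM_single')
      moreover have "(\<lambda>f k. f (\<kappa> * real (Suc k)) - f (\<kappa> * real k))
          \<in> measurable (Pi\<^sub>M UNIV (\<lambda>_. count_space (UNIV::nat set))) (Pi\<^sub>M UNIV (\<lambda>_. count_space UNIV))"
        by (rule measurable_PiM_single') auto
      moreover have "(\<lambda>f i. mark (f i)) \<in> measurable (Pi\<^sub>M UNIV (\<lambda>_::nat. borel \<Otimes>\<^sub>M borel)) (Pi\<^sub>M UNIV (\<lambda>_. borel))"
        by (rule measurable_PiM_single') auto
      ultimately show ?thesis
        unfolding A_def X_def by (rule indep_pair_compose)
    qed
    show "prob {\<omega> \<in> space M. A k \<omega> = b} = exp (- \<mu> k) * \<mu> k ^ b / fact b" for k b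
      using arrivals grid[of k] by (simp add: A_def \<mu>_def inhom_poisson_process_def del: of_nat_Suc)
    show "0 \<le> \<mu> k \<and> \<mu> k \<le> lamh * \<kappa>" for k
      using integral_bounds[OF grid(2), of lam lamh k] lam_bounds unfolding grid(3) \<mu>_def by simp
    show "0 \<le> snd (X i \<omega>) \<and> snd (X i \<omega>) \<le> fst (X i \<omega>)" for i \<omega>
      by (simp add: X_def mark_def)
  qed

  have fstX: "fst (X i \<omega>) = max 0 (S i \<omega>)" for i \<omega> by (simp add: X_def mark_def)
  have sndX: "(\<integral>\<^sup>+ \<omega>. ennreal (snd (X i \<omega>)) \<partial>M) = ennreal (sbar * T y0)" for i
  proof -
    define E where "E = {\<omega> \<in> space M. ennreal y0 < Y i \<omega>}"
    have E [measurable]: "E \<in> events" unfolding E_def by measurable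
    \<comment> \<open>The product form enters here, by passing to the complement in the patience
      variable.\<close>
    have ind: "prob ({\<omega> \<in> space M. S i \<omega> \<le> s} \<inter> E) = prob {\<omega> \<in> space M. S i \<omega> \<le> s} * prob E" for s
    proof -
      have "{\<omega> \<in> space M. S i \<omega> \<le> s} \<inter> E
          = {\<omega> \<in> space M. S i \<omega> \<le> s} - {\<omega> \<in> space M. S i \<omega> \<le> s \<and> Y i \<omega> \<le> ennreal y0}"
        by (auto simp: E_def)
      then have "prob ({\<omega> \<in> space M. S i \<omega> \<le> s} \<inter> E)
          = prob {\<omega> \<in> space M. S i \<omega> \<le> s} - prob {\<omega> \<in> space M. S i \<omega> \<le> s \<and> Y i \<omega> \<le> ennreal y0}"
        by (simp add: finite_measure_Diff subset_eq)
      also have "\<dots> = G s * T y0"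
        by (simp add: marks_cdf product_form G_cdf[symmetric] T_def right_diff_distrib)
      finally show ?thesis by (simp add: G_cdf[symmetric] T_prob[of y0 i] E_def)
    qed
    have "(\<integral>\<^sup>+ \<omega>. ennreal (snd (X i \<omega>)) \<partial>M) = (\<integral>\<^sup>+ \<omega>. ennreal (max 0 (S i \<omega>)) * indicator E \<omega> \<partial>M)"
      by (intro nn_integral_cong) (simp add: X_def mark_def E_def indicator_def)
    also have "\<dots> = ennreal (prob E) * (\<integral>\<^sup>+ \<omega>. ennreal (max 0 (S i \<omega>)) \<partial>M)"
      by (rule nn_integral_indicator_indep_cdf[where h="\<lambda>x. ennreal (max 0 x)"]) (use ind in auto)
    also have "\<dots> = ennreal (sbar * T y0)"
      using sbar0 by (simp only: sbar) (simp add: E_def T_prob[of y0 i] ennreal_mult' mult.commute)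
    finally show ?thesis .
  qed
  \<comment> \<open>Mean patient work per period at the maximal rate, compared with the service
    capacity \<open>\<kappa>\<close>.\<close>
  have drift: "lamh * \<kappa> * (sbar * T y0) < \<kappa>"
    using mult_strict_left_mono[OF y0(2) kappa_pos] by (simp add: mult_ac)
  \<comment> \<open>All services have the same law, so a truncation level found for customer 0
    serves every customer.\<close>
  have ui: "\<exists>c\<ge>0. \<forall>i. (\<integral>\<^sup>+ \<omega>. ennreal (max 0 (fst (X i \<omega>) - c)) \<partial>M) \<le> ennreal \<theta>" if "0 < \<theta>" for \<theta>
  proof -
    have "(\<lambda>c::nat. \<integral>\<^sup>+ \<omega>. ennreal (max 0 (S 0 \<omega>) - real c) \<partial>M) \<longlonglongrightarrow> 0"
      by (rule excess_integral_tendsto_0) (auto simp: sbar simp del: max_0L ennreal_max_0)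
    then have "\<forall>\<^sub>F c::nat in sequentially. (\<integral>\<^sup>+ \<omega>. ennreal (max 0 (S 0 \<omega>) - real c) \<partial>M) < ennreal \<theta>"
      using that by (intro order_tendstoD) auto
    then obtain c :: nat where c: "(\<integral>\<^sup>+ \<omega>. ennreal (max 0 (S 0 \<omega>) - real c) \<partial>M) < ennreal \<theta>"
      using eventually_happens by force
    have "(\<integral>\<^sup>+ \<omega>. ennreal (max 0 (fst (X i \<omega>) - real c)) \<partial>M) \<le> ennreal \<theta>" for i
    proof -
      have "(\<integral>\<^sup>+ \<omega>. ennreal (max 0 (fst (X i \<omega>) - real c)) \<partial>M) = (\<integral>\<^sup>+ \<omega>. ennreal (max 0 (S i \<omega>) - real c) \<partial>M)"
        by (simp add: fstX)
      also have "\<dots> = (\<integral>\<^sup>+ \<omega>. ennreal (max 0 (S 0 \<omega>) - real c) \<partial>M)"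
        using IG[of "\<lambda>x. ennreal (max 0 x - real c)" i] IG[of "\<lambda>x. ennreal (max 0 x - real c)" 0] by simp
      finally show ?thesis using c by simp
    qed
    then show ?thesis by (intro exI[of _ "real c"]) simp
  qed

  have moment: "(\<integral>\<^sup>+ \<omega>. eta_star \<kappa> (\<lambda>t. N t \<omega>) (\<lambda>i. S i \<omega>) (\<lambda>i. Y i \<omega>) ^ Suc n \<partial>M) < \<infinity>"
    if fin: "(\<integral>\<^sup>+ x. ennreal (x ^ Suc n) * indicator {0..} x \<partial>interval_measure G) < \<infinity>" for n
  proof -
    define e where "e = enn2real (\<integral>\<^sup>+ x. ennreal (x ^ Suc n) * indicator {0..} x \<partial>interval_measure G)"
    have e: "(\<integral>\<^sup>+ \<omega>. ennreal (fst (X i \<omega>) ^ Suc n) \<partial>M) \<le> ennreal e" for i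
    proof -
      have "(\<integral>\<^sup>+ \<omega>. ennreal (fst (X i \<omega>) ^ Suc n) \<partial>M) = (\<integral>\<^sup>+ x. ennreal (max 0 x ^ Suc n) \<partial>interval_measure G)"
        unfolding fstX by (rule IG[symmetric]) measurable
      also have "\<dots> = (\<integral>\<^sup>+ x. ennreal (x ^ Suc n) * indicator {0..} x \<partial>interval_measure G)"
        by (intro nn_integral_cong) (auto simp: indicator_def max_def)
      finally show ?thesis using fin by (simp add: e_def)
    qed
    let ?B = "\<lambda>k \<omega>. bound_count \<kappa> (y0 + \<kappa>) (\<lambda>j. A j \<omega>) (\<lambda>i. X i \<omega>) k"
    have "(\<integral>\<^sup>+ \<omega>. eta_star \<kappa> (\<lambda>t. N t \<omega>) (\<lambda>i. S i \<omega>) (\<lambda>i. Y i \<omega>) ^ Suc n \<partial>M)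
        \<le> (\<integral>\<^sup>+ \<omega>. (SUP k. of_nat (?B k \<omega>)) ^ Suc n \<partial>M)"
    proof (rule nn_integral_mono_AE)
      have "AE \<omega> in M. \<forall>i. 0 < S i \<omega>" using support_S by (simp add: AE_all_countable)
      then show "AE \<omega> in M. eta_star \<kappa> (\<lambda>t. N t \<omega>) (\<lambda>i. S i \<omega>) (\<lambda>i. Y i \<omega>) ^ Suc n
          \<le> (SUP k. of_nat (?B k \<omega>)) ^ Suc n"
      proof (rule AE_mp, intro AE_I2 impI power_mono_ennreal)
        fix \<omega> assume \<omega>: "\<omega> \<in> space M" and pos: "\<forall>i. 0 < S i \<omega>"
        then have S0: "0 \<le> S i \<omega>" for i by (simp add: less_imp_le)
        show "eta_star \<kappa> (\<lambda>t. N t \<omega>) (\<lambda>i. S i \<omega>) (\<lambda>i. Y i \<omega>) \<le> (SUP k. of_nat (?B k \<omega>))"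
          by (rule eta_star_le_bound_count[OF path[OF \<omega>] kappa_pos y0(1) S0])
             (use S0 in \<open>auto simp: A_def X_def mark_def max_def\<close>)
      qed
    qed
    also have "\<dots> < \<infinity>"
      using kappa_pos y0(1) sbar0
      by (intro bound_count_moment_finite[where p="sbar * T y0" and e=e] drift e ui)
         (auto simp: sndX T_prob[of _ 0] e_def)
    finally show ?thesis .
  qed
  show ?thesis
  proof (intro conjI impI)
    show "(\<integral>\<^sup>+ \<omega>. eta_star \<kappa> (\<lambda>t. N t \<omega>) (\<lambda>i. S i \<omega>) (\<lambda>i. Y i \<omega>) \<partial>M) < \<infinity>"
      using moment[of 0] mean_finite by simp
    show "(\<integral>\<^sup>+ \<omega>. eta_star \<kappa> (\<lambda>t. N t \<omega>) (\<lambda>i. S i \<omega>) (\<lambda>i. Y i \<omega>) ^ m \<partial>M) < \<infinity>"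
      if "2 \<le> m \<and> (\<integral>\<^sup>+ x. ennreal (x ^ m) * indicator {0..} x \<partial>interval_measure G) < \<infinity>"
      using moment[of "m - 1"] that by simp
  qed
qed

end
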